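(* Let $n\ge2$, $\mathfrak u=\mathfrak u_{r,s}(\mathfrak{so}_{2n+1})$ as in the context, and $\mathfrak b$ its Hopf subalgebra generated by $e_i,\omega_i^{\pm1}$ $(1\le i\le n)$. With $t=\prod_{i=1}^n(1+\omega_i+\cdots+\omega_i^{\ell-1})$ and $x=\widehat{\mathcal E}_1\cdots\widehat{\mathcal E}_n$, where $\widehat{\mathcal E}_i=\mathcal E_{i,i}^{\ell-1}\mathcal E_{i,i+1}^{\ell-1}\cdots\mathcal E_{i,n}^{\ell-1}\mathcal E_{i,n'}^{\ell-1}\mathcal E_{i,(n-1)'}^{\ell-1}\cdots\mathcal E_{i,(i+1)'}^{\ell-1}$ $(1\le i<n)$ and $\widehat{\mathcal E}_n=\mathcal E_{n,n}^{\ell-1}$, the element $y'=xt$ is a right integral in $\mathfrak b$, i.e. $y'b=\varepsilon(b)y'$ for all $b\in\mathfrak b$.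
   Context: Standing setting: $r$ a primitive $d$-th and $s$ a primitive $d'$-th root of unity, $r^3\ne s^3$, $r^4\ne s^4$, $\ell=\mathrm{lcm}(d,d')$ odd, $\mathbb K=\mathbb Q(r,s)$. $U_{r,s}(\mathfrak{so}_{2n+1})$ is generated by $e_i,f_i,\omega_i^{\pm1},\omega_i'^{\pm1}$ ($1\le i\le n$) with: $\omega$'s commute, invertible; $\omega_je_i\omega_j^{-1}=\langle\omega_i',\omega_j\rangle e_i$, $\omega_jf_i\omega_j^{-1}=\langle\omega_i',\omega_j\rangle^{-1}f_i$, $\omega_j'e_i\omega_j'^{-1}=\langle\omega_j',\omega_i\rangle^{-1}e_i$, $\omega_j'f_i\omega_j'^{-1}=\langle\omega_j',\omega_i\rangle f_i$, where $\langle\omega_i',\omega_i\rangle=r^2s^{-2}$ ($i<n$), $\langle\omega_n',\omega_n\rangle=rs^{-1}$, $\langle\omega_i',\omega_{i+1}\rangle=r^{-2}$, $\langle\omega_{i+1}',\omega_i\rangle=s^2$, others $1$; $e_if_j-f_je_i=\delta_{ij}(\omega_i-\omega_i')/(r_i-s_i)$ ($r_i=r^2,s_i=s^2$ for $i<n$; $r_n=r,s_n=s$); Serre relations $(\mathrm{ad}_le_i)^{1-a_{ij}}(e_j)=0=(\mathrm{ad}_rf_i)^{1-a_{ij}}(f_j)$, $i\ne j$, $(a_{ij})$ the $B_n$ Cartan matrix ($a_{n,n-1}=-2$, $a_{n-1,n}=-1$). Hopf structure: $\omega$'s group-like, $\Delta(e_i)=e_i\otimes1+\omega_i\otimes e_i$,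 $\Delta(f_i)=1\otimes f_i+f_i\otimes\omega_i'$, $\varepsilon(e_i)=0$, $\varepsilon(\omega_i)=1$, $S(e_i)=-\omega_i^{-1}e_i$, $S(f_i)=-f_i\omega_i'^{-1}$. Root vectors $\mathcal E_{i,i}=e_i$, $\mathcal E_{i,j}=e_i\mathcal E_{i+1,j}-r^2\mathcal E_{i+1,j}e_i$ ($i<j\le n$), $\mathcal E_{i,n'}=\mathcal E_{i,n}e_n-rs\,e_n\mathcal E_{i,n}$, $\mathcal E_{i,j'}=\mathcal E_{i,(j+1)'}e_j-s^{-2}e_j\mathcal E_{i,(j+1)'}$ ($i<j<n$); $\mathcal F_{i,i}=f_i$, $\mathcal F_{i,j}=\mathcal F_{i+1,j}f_i-s^2f_i\mathcal F_{i+1,j}$, $\mathcal F_{i,n'}=f_n\mathcal F_{i,n}-rs\,\mathcal F_{i,n}f_n$, $\mathcal F_{i,j'}=f_j\mathcal F_{i,(j+1)'}-r^{-2}\mathcal F_{i,(j+1)'}f_j$. $\mathfrak u_{r,s}(\mathfrak{so}_{2n+1})$ is the quotient Hopf algebra of $U_{r,s}(\mathfrak{so}_{2n+1})$ by the ideal generated by all $\mathcal E_{k,j}^\ell,\mathcal E_{k,j'}^\ell,\mathcal F_{k,j}^\ell,\mathcal F_{k,j'}^\ell,\omega_k^\ell-1,(\omega_k')^\ell-1$. *)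

theory Defs
  imports Complex_Main
begin

text \<open>
We encode the quotient Hopf algebra u = u_{r,s}(so_{2n+1}) (over K = Q(r,s)) by its universal
property: an identity holds in u iff it holds for the images of the generators in every
K-algebra A satisfying all defining relations of u (u itself being the initial such algebra).
A model is a ring 'a together with a K-algebra structure map sc (a ring homomorphism on K
with central image) and the images g of the generators.
\<close>

definition primitive_root :: "nat \<Rightarrow> complex \<Rightarrow> bool" where
  "primitive_root d z \<longleftrightarrow> 0 < d \<and> z ^ d = 1 \<and> (\<forall>k. 0 < k \<and> k < d \<longrightarrow> z ^ k \<noteq> 1)"

definition is_subfield :: "complex set \<Rightarrow> bool" where
  "is_subfield F \<longleftrightarrow> 0 \<in> F \<and> 1 \<in> F \<and> (\<forall>a\<in>F. \<forall>b\<in>F. a + b \<in> F \<and> a - b \<in> F \<and> a * b \<in> F)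
     \<and> (\<forall>a\<in>F. inverse a \<in> F)"

definition Kfield :: "complex \<Rightarrow> complex \<Rightarrow> complex set" where
  "Kfield r s = \<Inter>{F. is_subfield F \<and> r \<in> F \<and> s \<in> F}"

definition K_algebra_map :: "complex set \<Rightarrow> (complex \<Rightarrow> 'a::ring_1) \<Rightarrow> bool" where
  "K_algebra_map K sc \<longleftrightarrow> sc 1 = 1 \<and>
     (\<forall>a\<in>K. \<forall>b\<in>K. sc (a + b) = sc a + sc b \<and> sc (a * b) = sc a * sc b) \<and>
     (\<forall>a\<in>K. \<forall>x. sc a * x = x * sc a)"

datatype gen = E nat | F nat | W nat | Wi nat | Wp nat | Wpi nat

definition pairing :: "nat \<Rightarrow> complex \<Rightarrow> complex \<Rightarrow> nat \<Rightarrow> nat \<Rightarrow> complex" where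
  "pairing n r s i j =
     (if i = j then (if i < n then r^2 * inverse (s^2) else r * inverse s)
      else if j = i + 1 then inverse (r^2)
      else if i = j + 1 then s^2
      else 1)"

definition r_i :: "nat \<Rightarrow> complex \<Rightarrow> nat \<Rightarrow> complex" where
  "r_i n r i = (if i < n then r^2 else r)"

definition cartan_B :: "nat \<Rightarrow> nat \<Rightarrow> nat \<Rightarrow> int" where
  "cartan_B n i j =
     (if i = j then 2
      else if i = n \<and> j = n - 1 then -2
      else if j = i + 1 \<or> i = j + 1 then -1
      else 0)"

definition serre_exp :: "nat \<Rightarrow> nat \<Rightarrow> nat \<Rightarrow> nat" where
  "serre_exp n i j = nat (1 - cartan_B n i j)"

text \<open>Left adjoint action of e_i (Delta(e_i) = e_i\<otimes>1 + omega_i\<otimes>e_i, S(e_i) = -omega_i^{-1} e_i),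
  and right adjoint action of f_i (Delta(f_i) = 1\<otimes>f_i + f_i\<otimes>omega'_i, S(f_i) = -f_i omega'_i^{-1}).\<close>
definition adl_e :: "(gen \<Rightarrow> 'a::ring_1) \<Rightarrow> nat \<Rightarrow> 'a \<Rightarrow> 'a" where
  "adl_e g i y = g (E i) * y - g (W i) * y * g (Wi i) * g (E i)"

definition adr_f :: "(gen \<Rightarrow> 'a::ring_1) \<Rightarrow> nat \<Rightarrow> 'a \<Rightarrow> 'a" where
  "adr_f g i y = y * g (F i) - g (F i) * g (Wpi i) * y * g (Wp i)"

text \<open>Root vectors. Eup sc r e i m = E_{i,i+m}.\<close>
fun Eup :: "(complex \<Rightarrow> 'a::ring_1) \<Rightarrow> complex \<Rightarrow> (nat \<Rightarrow> 'a) \<Rightarrow> nat \<Rightarrow> nat \<Rightarrow> 'a" where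
  "Eup sc r e i 0 = e i"
| "Eup sc r e i (Suc m) = e i * Eup sc r e (Suc i) m - sc (r^2) * Eup sc r e (Suc i) m * e i"

definition RE :: "(complex \<Rightarrow> 'a::ring_1) \<Rightarrow> complex \<Rightarrow> (nat \<Rightarrow> 'a) \<Rightarrow> nat \<Rightarrow> nat \<Rightarrow> 'a" where
  "RE sc r e i j = Eup sc r e i (j - i)"

text \<open>Epr sc r s n e i m = E_{i,(n-m)'}\<close>
fun Epr :: "(complex \<Rightarrow> 'a::ring_1) \<Rightarrow> complex \<Rightarrow> complex \<Rightarrow> nat \<Rightarrow> (nat \<Rightarrow> 'a) \<Rightarrow> nat \<Rightarrow> nat \<Rightarrow> 'a" where
  "Epr sc r s n e i 0 = RE sc r e i n * e n - sc (r * s) * e n * RE sc r e i n"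
| "Epr sc r s n e i (Suc m) =
     Epr sc r s n e i m * e (n - Suc m) - sc (inverse (s^2)) * e (n - Suc m) * Epr sc r s n e i m"

definition REp :: "(complex \<Rightarrow> 'a::ring_1) \<Rightarrow> complex \<Rightarrow> complex \<Rightarrow> nat \<Rightarrow> (nat \<Rightarrow> 'a) \<Rightarrow> nat \<Rightarrow> nat \<Rightarrow> 'a" where
  "REp sc r s n e i j = Epr sc r s n e i (n - j)"

text \<open>Fup sc s f i m = F_{i,i+m}\<close>
fun Fup :: "(complex \<Rightarrow> 'a::ring_1) \<Rightarrow> complex \<Rightarrow> (nat \<Rightarrow> 'a) \<Rightarrow> nat \<Rightarrow> nat \<Rightarrow> 'a" where
  "Fup sc s f i 0 = f i"
| "Fup sc s f i (Suc m) = Fup sc s f (Suc i) m * f i - sc (s^2) * f i * Fup sc s f (Suc i) m"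

definition RF :: "(complex \<Rightarrow> 'a::ring_1) \<Rightarrow> complex \<Rightarrow> (nat \<Rightarrow> 'a) \<Rightarrow> nat \<Rightarrow> nat \<Rightarrow> 'a" where
  "RF sc s f i j = Fup sc s f i (j - i)"

fun Fpr :: "(complex \<Rightarrow> 'a::ring_1) \<Rightarrow> complex \<Rightarrow> complex \<Rightarrow> nat \<Rightarrow> (nat \<Rightarrow> 'a) \<Rightarrow> nat \<Rightarrow> nat \<Rightarrow> 'a" where
  "Fpr sc r s n f i 0 = f n * RF sc s f i n - sc (r * s) * RF sc s f i n * f n"
| "Fpr sc r s n f i (Suc m) =
     f (n - Suc m) * Fpr sc r s n f i m - sc (inverse (r^2)) * Fpr sc r s n f i m * f (n - Suc m)"

definition RFp :: "(complex \<Rightarrow> 'a::ring_1) \<Rightarrow> complex \<Rightarrow> complex \<Rightarrow> nat \<Rightarrow> (nat \<Rightarrow> 'a) \<Rightarrow> nat \<Rightarrow> nat \<Rightarrow> 'a" where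
  "RFp sc r s n f i j = Fpr sc r s n f i (n - j)"

definition omega_gens :: "nat \<Rightarrow> gen set" where
  "omega_gens n = {x. \<exists>i. 1 \<le> i \<and> i \<le> n \<and> (x = W i \<or> x = Wi i \<or> x = Wp i \<or> x = Wpi i)}"

definition u_model :: "nat \<Rightarrow> complex \<Rightarrow> complex \<Rightarrow> nat \<Rightarrow> (complex \<Rightarrow> 'a::ring_1) \<Rightarrow> (gen \<Rightarrow> 'a) \<Rightarrow> bool" where
  "u_model n r s l sc g \<longleftrightarrow>
     (\<forall>a\<in>omega_gens n. \<forall>b\<in>omega_gens n. g a * g b = g b * g a) \<and>
     (\<forall>i. 1 \<le> i \<and> i \<le> n \<longrightarrow>
        g (W i) * g (Wi i) = 1 \<and> g (Wi i) * g (W i) = 1 \<and>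
        g (Wp i) * g (Wpi i) = 1 \<and> g (Wpi i) * g (Wp i) = 1) \<and>
     (\<forall>i j. 1 \<le> i \<and> i \<le> n \<and> 1 \<le> j \<and> j \<le> n \<longrightarrow>
        g (W j) * g (E i) * g (Wi j) = sc (pairing n r s i j) * g (E i) \<and>
        g (W j) * g (F i) * g (Wi j) = sc (inverse (pairing n r s i j)) * g (F i) \<and>
        g (Wp j) * g (E i) * g (Wpi j) = sc (inverse (pairing n r s j i)) * g (E i) \<and>
        g (Wp j) * g (F i) * g (Wpi j) = sc (pairing n r s j i) * g (F i) \<and>
        g (E i) * g (F j) - g (F j) * g (E i) =
          (if i = j then sc (inverse (r_i n r i - r_i n s i)) * (g (W i) - g (Wp i)) else 0)) \<and>
     (\<forall>i j. 1 \<le> i \<and> i \<le> n \<and> 1 \<le> j \<and> j \<le> n \<and> i \<noteq> j \<longrightarrow>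
        (adl_e g i ^^ serre_exp n i j) (g (E j)) = 0 \<and>
        (adr_f g i ^^ serre_exp n i j) (g (F j)) = 0) \<and>
     (\<forall>k j. 1 \<le> k \<and> k \<le> j \<and> j \<le> n \<longrightarrow>
        RE sc r (\<lambda>i. g (E i)) k j ^ l = 0 \<and> RF sc s (\<lambda>i. g (F i)) k j ^ l = 0) \<and>
     (\<forall>k j. 1 \<le> k \<and> k < j \<and> j \<le> n \<longrightarrow>
        REp sc r s n (\<lambda>i. g (E i)) k j ^ l = 0 \<and> RFp sc r s n (\<lambda>i. g (F i)) k j ^ l = 0) \<and>
     (\<forall>k. 1 \<le> k \<and> k \<le> n \<longrightarrow> g (W k) ^ l = 1 \<and> g (Wp k) ^ l = 1)"

text \<open>Elements of the Hopf subalgebra b: K-linear combinations of words in e_i, omega_i, omega_i^{-1}.\<close>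
datatype bgen = bE nat | bW nat | bWi nat

fun bgen_gen :: "bgen \<Rightarrow> gen" where
  "bgen_gen (bE i) = E i" | "bgen_gen (bW i) = W i" | "bgen_gen (bWi i) = Wi i"

fun bgen_idx :: "bgen \<Rightarrow> nat" where
  "bgen_idx (bE i) = i" | "bgen_idx (bW i) = i" | "bgen_idx (bWi i) = i"

fun bgen_eps :: "bgen \<Rightarrow> complex" where
  "bgen_eps (bE i) = 0" | "bgen_eps (bW i) = 1" | "bgen_eps (bWi i) = 1"

type_synonym bpoly = "(complex \<times> bgen list) list"

definition bpoly_ok :: "nat \<Rightarrow> complex set \<Rightarrow> bpoly \<Rightarrow> bool" where
  "bpoly_ok n K p \<longleftrightarrow> (\<forall>(c, w) \<in> set p. c \<in> K \<and> (\<forall>x \<in> set w. 1 \<le> bgen_idx x \<and> bgen_idx x \<le> n))"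

definition b_eval :: "(complex \<Rightarrow> 'a::ring_1) \<Rightarrow> (gen \<Rightarrow> 'a) \<Rightarrow> bpoly \<Rightarrow> 'a" where
  "b_eval sc g p = sum_list (map (\<lambda>(c, w). sc c * prod_list (map (g \<circ> bgen_gen) w)) p)"

definition b_eps :: "bpoly \<Rightarrow> complex" where
  "b_eps p = sum_list (map (\<lambda>(c, w). c * prod_list (map bgen_eps w)) p)"

definition t_elt :: "nat \<Rightarrow> nat \<Rightarrow> (gen \<Rightarrow> 'a::ring_1) \<Rightarrow> 'a" where
  "t_elt n l g = prod_list (map (\<lambda>i. \<Sum>k<l. g (W i) ^ k) [1..<n+1])"

definition Ehat :: "nat \<Rightarrow> complex \<Rightarrow> complex \<Rightarrow> nat \<Rightarrow> (complex \<Rightarrow> 'a::ring_1) \<Rightarrow> (gen \<Rightarrow> 'a) \<Rightarrow> nat \<Rightarrow> 'a" where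
  "Ehat n r s l sc g i =
     prod_list (map (\<lambda>j. RE sc r (\<lambda>k. g (E k)) i j ^ (l - 1)) [i..<n+1]) *
     prod_list (map (\<lambda>j. REp sc r s n (\<lambda>k. g (E k)) i j ^ (l - 1)) (rev [i+1..<n+1]))"

definition x_elt :: "nat \<Rightarrow> complex \<Rightarrow> complex \<Rightarrow> nat \<Rightarrow> (complex \<Rightarrow> 'a::ring_1) \<Rightarrow> (gen \<Rightarrow> 'a) \<Rightarrow> 'a" where
  "x_elt n r s l sc g = prod_list (map (Ehat n r s l sc g) [1..<n+1])"

end

theory Submission
  imports Defs
begin

text \<open>
  Moving \<open>e_i\<close> to the left across \<open>t\<close> only rescales the powers of the \<open>\<omega>_j\<close> and \<open>t \<omega>_i = t\<close>, so everything
  reduces to \<open>x e_i = 0\<close>. Fix \<open>i\<close> and let \<open>x_0, \<dots>, x_N\<close> be the root vectors of the \<open>i\<close>-th block in the order in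
  which they occur in \<open>\<^bold>E_i\<close>, the \<open>i\<close>-th factor of \<open>x\<close>. They behave like a weight basis of the vector representation: for
  \<open>k > i\<close> every \<open>e_k\<close> commutes with \<open>x_m\<close> up to a unit, except that exactly one \<open>e_k\<close> satisfies
  \<open>x_{m+1} = x_m e_k - c e_k x_m\<close>. Hence the right ideal generated by \<open>x_0, \<dots>, x_N\<close> is stable under left multiplication by
  all \<open>e_k\<close> with \<open>k > i\<close>, and so the later factors \<open>\<^bold>E_{i+1} \<dots> \<^bold>E_n\<close> send \<open>e_i = x_0\<close> into it.
  Moreover \<open>x_m x_j\<close> lies in the right ideal generated by \<open>x_0, \<dots>, x_{m-1}\<close> whenever \<open>j < m\<close>; since all \<open>x_m\<close> have
  vanishing \<open>l\<close>-th power, \<open>\<^bold>E_i = x_0^{l-1} \<dots> x_N^{l-1}\<close> annihilates every \<open>x_j\<close>. The hypotheses \<open>r^4 \<noteq> s^4\<close> and \<open>r^3 \<noteq> s^3\<close> enter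
  through the units \<open>r^2 + s^2\<close> and \<open>r^2 + r s + s^2\<close> by which two rank three identities are divided.
\<close>

section \<open>Brackets twisted by central scalars\<close>

definition central :: "'a::ring_1 \<Rightarrow> bool" where
  "central c \<longleftrightarrow> (\<forall>z. z * c = c * z)"

definition central_unit :: "'a::ring_1 \<Rightarrow> bool" where
  "central_unit c \<longleftrightarrow> central c \<and> (\<exists>c'. central c' \<and> c * c' = 1)"

text \<open>The scalar stays existential: its value rarely matters later, only that it is a central
  unit. This makes the relation symmetric and lets a product \<open>z * y\<close> be absorbed into a
  right ideal containing \<open>y\<close>.\<close>

definition qcommute :: "'a::ring_1 \<Rightarrow> 'a \<Rightarrow> bool" where
  "qcommute z y \<longleftrightarrow> (\<exists>c. central_unit c \<and> z * y = c * (y * z))"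

lemma centralD: "central c \<Longrightarrow> z * c = c * z"
  by (simp add: central_def)

lemma left_commute: "x * c = c * x \<Longrightarrow> x * (c * z) = c * (x * z)" for c :: "'a::ring_1"
  by (metis mult.assoc)

lemma central_one: "central 1"
  by (simp add: central_def)

lemma central_mult: "central a \<Longrightarrow> central b \<Longrightarrow> central (a * b)"
  unfolding central_def by (metis mult.assoc)

lemma central_unit_central: "central_unit c \<Longrightarrow> central c"
  by (simp add: central_unit_def)

lemma central_unit_one: "central_unit 1"
  unfolding central_unit_def using central_one by fastforce

lemma central_unit_mult:
  assumes "central_unit a" "central_unit b"
  shows "central_unit (a * b)"
proof -
  obtain a' b' where "central a" "central b" and a': "central a'" "a * a' = 1"
    and b': "central b'" "b * b' = 1"
    using assms by (auto simp: central_unit_def)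
  have "a * b * (b' * a') = a * (b * b') * a'" by (simp add: mult.assoc)
  also have "\<dots> = 1" using a' b' by simp
  finally show ?thesis
    unfolding central_unit_def using \<open>central a\<close> \<open>central b\<close> a' b' by (blast intro: central_mult)
qed

lemma central_unit_cancel:
  assumes "central_unit c" "c * x = c * y"
  shows "x = y"
proof -
  obtain c' where c': "central c" "c * c' = 1"
    using assms(1) by (auto simp: central_unit_def)
  then have "c' * c = 1" by (simp add: centralD)
  then show ?thesis using assms(2) by (metis mult.assoc mult_1_left)
qed

lemma central_unit_mult_eq_0: "central_unit c \<Longrightarrow> c * x = 0 \<Longrightarrow> x = 0"
  using central_unit_cancel[of c x 0] by simp

lemma qcommuteI: "central_unit c \<Longrightarrow> z * y = c * (y * z) \<Longrightarrow> qcommute z y"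
  by (auto simp: qcommute_def)

lemma commute_qcommute: "z * y = y * z \<Longrightarrow> qcommute z y"
  using qcommuteI[OF central_unit_one] by simp

lemma qcommuteI':
  assumes "central_unit c" "y * z = c * (z * y)"
  shows "qcommute z y"
proof -
  obtain c' where c: "central c" "central c'" "c * c' = 1"
    using assms(1) by (auto simp: central_unit_def)
  have c'': "c' * c = 1" using c by (metis centralD)
  have "c' * (y * z) = z * y" by (metis assms(2) c'' mult.assoc mult_1_left)
  moreover have "central_unit c'" using c c'' by (auto simp: central_unit_def)
  ultimately show ?thesis using qcommuteI by metis
qed

lemma qcommute_sym: "qcommute z y \<Longrightarrow> qcommute y z"
  by (metis qcommuteI' qcommute_def)

section \<open>Identities for twisted brackets\<close>

lemma scaled_commute_bracket:
  fixes z x y :: "'a::ring_1"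
  assumes "central c" "central u" "central v"
    and "z * x = u * (x * z)" "z * y = v * (y * z)"
  shows "z * (x * y - c * (y * x)) = (u * v) * ((x * y - c * (y * x)) * z)"
proof -
  note cen = assms(1-3)[THEN centralD]
  have xy: "z * (x * y) = (u * v) * (x * y * z)"
  proof -
    have "z * (x * y) = u * (x * (z * y))" by (metis assms(4) mult.assoc)
    then show ?thesis by (simp add: assms(5) mult.assoc left_commute[OF cen(3)])
  qed
  have yx: "z * (y * x) = (u * v) * (y * x * z)"
  proof -
    have "z * (y * x) = v * (y * (z * x))" by (metis assms(5) mult.assoc)
    then show ?thesis
      by (simp add: assms(4) mult.assoc left_commute[OF cen(2), of y])
         (metis cen(3) mult.assoc)
  qed
  have "z * (c * (y * x)) = (u * v) * (c * (y * x * z))"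
    by (metis yx cen(1) mult.assoc)
  then show ?thesis by (simp add: algebra_simps xy[simplified mult.assoc])
qed

lemma commute_bracket:
  fixes z x y :: "'a::ring_1"
  assumes "central c" "z * x = x * z" "z * y = y * z"
  shows "z * (x * y - c * (y * x)) = (x * y - c * (y * x)) * z"
  using scaled_commute_bracket[OF assms(1) central_one central_one] assms by simp

lemma bracket_scaled_commute:
  fixes z x y :: "'a::ring_1"
  assumes "central c" "central u" "x * z = z * x" "y * z = u * (z * y)"
  shows "(x * y - c * (y * x)) * z = u * (z * (x * y - c * (y * x)))"
proof -
  note cs = assms(1)[THEN centralD] assms(2)[THEN centralD]
  note cs' = cs(1)[of z] cs(2)[of x] cs(2)[of c] cs(1)[of z, THEN left_commute]
    cs(2)[of x, THEN left_commute] cs(2)[of c, THEN left_commute]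
  have y: "y * (z * w) = u * (z * (y * w))" and x: "x * (z * w) = z * (x * w)" for w
    by (metis assms(4) mult.assoc) (metis assms(3) mult.assoc)
  show ?thesis by (simp add: algebra_simps assms(3,4) x y cs')
qed

lemma qcommute_bracket:
  assumes "central c" "qcommute z x" "qcommute z y"
  shows "qcommute z (x * y - c * (y * x))"
proof -
  obtain u v where u: "central_unit u" "z * x = u * (x * z)"
    and v: "central_unit v" "z * y = v * (y * z)"
    using assms by (auto simp: qcommute_def)
  show ?thesis
    using scaled_commute_bracket[OF assms(1) _ _ u(2) v(2)] u(1) v(1)
    by (intro qcommuteI[of "u * v"]) (simp_all add: central_unit_mult central_unit_central)
qed

text \<open>Both sides expand to the same four words once \<open>x\<close> and \<open>z\<close>
  commute. This Jacobi-type identity converts between left-growing and right-growing recursions for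
  root vectors.\<close>

lemma bracket_assoc:
  fixes x y z :: "'a::ring_1"
  assumes "central a" "central b" "x * z = z * x"
  shows "(x * y - a * (y * x)) * z - b * (z * (x * y - a * (y * x)))
       = x * (y * z - b * (z * y)) - a * ((y * z - b * (z * y)) * x)"
proof -
  have zx: "z * x = x * z" "\<And>w. z * (x * w) = x * (z * w)"
    by (metis assms(3)) (metis assms(3) mult.assoc)
  have c1: "x * (b * w) = b * (x * w)" "z * (a * w) = a * (z * w)" "b * (a * w) = a * (b * w)" for w
    using assms(1,2)[THEN centralD] by (metis mult.assoc)+
  show ?thesis by (simp add: algebra_simps zx c1)
qed

text \<open>Both expressions \<open>T b - c b T = X B - c B X\<close> for the iterated bracket \<open>Z\<close> allow one to move
  \<open>a\<close> across; eliminating \<open>T B - c d B T\<close> from the two results leaves \<open>(c + d) (Z a - a Z) = 0\<close>.\<close>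

lemma middle_commutes_bracket:
  fixes X a b c d :: "'a::ring_1"
  defines "T \<equiv> X * a - c * (a * X)"
  defines "B \<equiv> a * b - c * (b * a)"
  assumes cen: "central c" "central d" and inv: "central_unit (c + d)"
    and Xb: "X * b = b * X" and Ta: "T * a = d * (a * T)" and aB: "a * B = d * (B * a)"
  shows "a * (T * b - c * (b * T)) = (T * b - c * (b * T)) * a"
proof -
  define Z where "Z = T * b - c * (b * T)"
  have Z': "Z = X * B - c * (B * X)"
    unfolding Z_def T_def B_def using bracket_assoc[OF cen(1,1) Xb] by simp
  note C = cen[THEN centralD]
  note cs = C(1)[of a] C(1)[of b] C(1)[of X] C(1)[of d] C(2)[of a] C(2)[of b] C(2)[of X]
  note cs' = cs cs[THEN left_commute]
  have "c * (Z * a) - d * (a * Z) + (T * B - c * (d * (B * T))) =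
     (T * a - d * (a * T)) * b - c * c * (b * (T * a - d * (a * T)))"
    unfolding Z_def B_def T_def by (simp add: algebra_simps cs')
  then have e1: "c * (Z * a) = d * (a * Z) - (T * B - c * (d * (B * T)))"
    using Ta by (simp add: algebra_simps)
  have "d * (Z * a) - c * (a * Z) - (T * B - c * (d * (B * T))) =
     - (X * (a * B - d * (B * a))) + c * c * ((a * B - d * (B * a)) * X)"
    unfolding Z' T_def B_def by (simp add: algebra_simps cs')
  then have e2: "d * (Z * a) = c * (a * Z) + (T * B - c * (d * (B * T)))"
    using aB by (simp add: algebra_simps)
  have "(c + d) * (a * Z) = (c + d) * (Z * a)"
    unfolding distrib_right e1 e2 by simp
  then show ?thesis using central_unit_cancel[OF inv] Z_def by simp
qed

text \<open>Bracketing the relations \<open>Y1 b = b Y1\<close> and \<open>X b = q q b X\<close> repeatedly with \<open>a\<close> yields two linear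
  relations between \<open>Y1 B2 - p p q q B2 Y1\<close>, \<open>Y2 B1\<close> and \<open>B1 Y2\<close>; eliminating the first of these leaves a multiple of
  \<open>Y2 B1 - B1 Y2\<close>.\<close>

lemma double_bracket_qcommute:
  fixes X a b p q :: "'a::ring_1"
  defines "Y1 \<equiv> X * a - p * p * (a * X)"
  defines "Y2 \<equiv> Y1 * a - p * q * (a * Y1)"
  defines "B1 \<equiv> b * a - p * p * (a * b)"
  defines "B2 \<equiv> B1 * a - p * q * (a * B1)"
  assumes p: "central_unit p" and q: "central_unit q"
    and inv: "central_unit (p * p + p * q + q * q)"
    and Y1b: "Y1 * b = b * Y1" and Xb: "X * b = q * q * (b * X)"
    and Y2a: "Y2 * a = q * q * (a * Y2)" and B2a: "B2 * a = q * q * (a * B2)"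
    and q': "central q'" "q * q' = 1"
  shows "(Y2 * b - q' * q' * (b * Y2)) * a = p * p * q * q * (a * (Y2 * b - q' * q' * (b * Y2)))"
proof -
  note C = p[THEN central_unit_central, THEN centralD] q[THEN central_unit_central, THEN centralD]
  note cs = C(2)[of p] C(1)[of a] C(1)[of b] C(1)[of X] C(1)[of Y1] C(1)[of Y2] C(1)[of B1] C(1)[of B2]
    C(2)[of a] C(2)[of b] C(2)[of X] C(2)[of Y1] C(2)[of Y2] C(2)[of B1] C(2)[of B2]
  have a_right: "X * a = Y1 + p * p * (a * X)" "Y1 * a = Y2 + p * q * (a * Y1)"
    "b * a = B1 + p * p * (a * b)" "B1 * a = B2 + p * q * (a * B1)"
    by (simp_all add: Y1_def Y2_def B1_def B2_def)
  have a_right': "x * a = y \<Longrightarrow> x * (a * w) = y * w" for x y w :: 'a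
    by (metis mult.assoc)
  note push = a_right Y2a B2a a_right[THEN a_right'] Y2a[THEN a_right'] B2a[THEN a_right']
    cs cs[THEN left_commute]
  \<comment> \<open>Relations I to V arise by bracketing an earlier relation with \<open>a\<close>.
    The twist is the product of the factors that the two letters pick up when passing
    \<open>a\<close>; here \<open>p * q\<close> from \<open>Y1\<close> and \<open>p * p\<close> from
    \<open>b\<close>.\<close>
  have I: "Y1 * B1 - p * q * (B1 * Y1) = b * Y2 - p * p * (Y2 * b)"
  proof -
    have "Y1 * B1 - p * q * (B1 * Y1) - (b * Y2 - p * p * (Y2 * b))
        = (Y1 * b - b * Y1) * a - p * p * p * q * (a * (Y1 * b - b * Y1))"
      by (simp add: algebra_simps push)
    then show ?thesis using Y1b by simp
  qed
  have II: "Y1 * B2 - p * p * q * q * (B2 * Y1) + p * (p + q) * (Y2 * B1) = q * (p + q) * (B1 * Y2)"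
  proof -
    define H where "H = (Y1 * B1 - p * q * (B1 * Y1)) - (b * Y2 - p * p * (Y2 * b))"
    have "Y1 * B2 - p * p * q * q * (B2 * Y1) + p * (p + q) * (Y2 * B1) - q * (p + q) * (B1 * Y2)
        = H * a - p * p * q * q * (a * H)"
      unfolding H_def by (simp add: algebra_simps push)
    then show ?thesis using I by (simp add: H_def)
  qed
  have III: "X * B1 - p * p * q * q * (B1 * X) = (q * q - p * p) * (b * Y1)"
  proof -
    have "X * B1 - p * p * q * q * (B1 * X) - (q * q - p * p) * (b * Y1)
       = (X * b - q * q * (b * X)) * a - p * p * p * p * (a * (X * b - q * q * (b * X)))
          - p * p * (Y1 * b - b * Y1)"
      by (simp add: algebra_simps push)
    then show ?thesis using Y1b Xb by simp
  qed
  have IV: "X * B2 - p * p * p * p * q * q * (B2 * X) + p * q * (Y1 * B1)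
      + p * q * (p * p - p * q - q * q) * (B1 * Y1) = (q * q - p * p) * (b * Y2)"
  proof -
    define H where "H = X * B1 - p * p * q * q * (B1 * X) - (q * q - p * p) * (b * Y1)"
    have "X * B2 - p * p * p * p * q * q * (B2 * X) + p * q * (Y1 * B1)
      + p * q * (p * p - p * q - q * q) * (B1 * Y1) - (q * q - p * p) * (b * Y2)
       = H * a - p * p * p * q * (a * H)"
      unfolding H_def by (simp add: algebra_simps push)
    then show ?thesis using III by (simp add: H_def)
  qed
  have V: "q * (p + q) * (Y1 * B2 - p * p * q * q * (B2 * Y1)) + p * p * q * q * (Y2 * B1)
      + q * (p * p * p - p * q * q - q * q * q) * (B1 * Y2) = 0"
  proof -
    define H where "H = X * B2 - p * p * p * p * q * q * (B2 * X) + p * q * (Y1 * B1)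
      + p * q * (p * p - p * q - q * q) * (B1 * Y1) - (q * q - p * p) * (b * Y2)"
    have "q * (p + q) * (Y1 * B2 - p * p * q * q * (B2 * Y1)) + p * p * q * q * (Y2 * B1)
      + q * (p * p * p - p * q * q - q * q * q) * (B1 * Y2)
       = H * a - p * p * q * q * (a * H)"
      unfolding H_def by (simp add: algebra_simps push)
    then show ?thesis using IV by (simp add: H_def)
  qed
  have VI: "Y2 * B1 = B1 * Y2"
  proof -
    define D where "D = Y1 * B2 - p * p * q * q * (B2 * Y1)"
    define U where "U = Y2 * B1"
    define W where "W = B1 * Y2"
    \<comment> \<open>\<open>q * (p + q)\<close> times II minus V: the terms in \<open>D\<close>
      cancel and the coefficients of \<open>U\<close> and \<open>W\<close> become opposite.\<close>
    have "p * q * (p * p + p * q + q * q) * (U - W) =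
      q * (p + q) * (D + p * (p + q) * U - q * (p + q) * W)
      - (q * (p + q) * D + p * p * q * q * U + q * (p * p * p - p * q * q - q * q * q) * W)"
      by (simp add: algebra_simps C(2)[of p] C(2)[of p, THEN left_commute])
    also have "\<dots> = 0" using II V by (simp add: D_def U_def W_def)
    finally have "p * q * (p * p + p * q + q * q) * (U - W) = 0" .
    then have "U - W = 0"
      by (rule central_unit_mult_eq_0[rotated]) (intro central_unit_mult p q inv)
    then show ?thesis by (simp add: U_def W_def)
  qed
  have "q' * q = 1" using q' C(2) by simp
  note Cq' = q'(1)[THEN centralD]
  have qq: "q * (q * (q' * (q' * w))) = w" for w
    using q' by (metis mult.assoc mult_1_left mult_1_right)
  have qq': "q' * (q' * (q * (q * w))) = w" for w
    using \<open>q' * q = 1\<close> by (metis mult.assoc mult_1_left mult_1_right)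
  have "p * p * q * q * (a * (Y2 * b - q' * q' * (b * Y2)))
      = p * p * (q * q * (a * Y2)) * b - p * p * (a * b * Y2)"
    by (simp add: algebra_simps qq Cq'[of a] Cq'[of a, THEN left_commute])
  also have "\<dots> = p * p * (Y2 * a * b) - p * p * (a * b * Y2)"
    unfolding Y2a[symmetric] by (simp add: mult.assoc)
  also have "\<dots> = Y2 * b * a - b * a * Y2 - (Y2 * B1 - B1 * Y2)"
    unfolding B1_def by (simp add: algebra_simps C(1)[of Y2] C(1)[of Y2, THEN left_commute])
  also have "\<dots> = Y2 * b * a - q' * q' * (b * (q * q * (a * Y2)))"
    by (simp add: VI qq' mult.assoc C(2)[of b] C(2)[of b, THEN left_commute])
  also have "\<dots> = (Y2 * b - q' * q' * (b * Y2)) * a"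
    unfolding Y2a[symmetric] by (simp add: algebra_simps)
  finally show ?thesis by simp
qed

text \<open>Bracketing \<open>u * v = k * (v * u)\<close> with \<open>b\<close>, which commutes with
  \<open>u\<close>, gives the same relation for \<open>u\<close> and \<open>w\<close>; bracketing
  that with \<open>a\<close>, which commutes with \<open>w\<close>, gives it for \<open>v\<close>
  and \<open>w\<close>. It is the inductive step along a row of root vectors.\<close>

lemma bracket_chain_scaled_commute:
  fixes u a b c k :: "'a::ring_1"
  defines "v \<equiv> u * a - c * (a * u)"
  defines "w \<equiv> v * b - c * (b * v)"
  assumes cen: "central c" "central k"
    and ub: "u * b = b * u" and aw: "a * w = w * a" and uv: "u * v = k * (v * u)"
  shows "v * w = k * (w * v)"
proof -
  note C = cen[THEN centralD]
  note cs = C(1)[of u] C(2)[of u] C(1)[of b] C(2)[of b] C(1)[of a] C(2)[of a] C(1)[of v] C(2)[of v]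
    C(1)[of w] C(2)[of w] C(2)[of c]
  note cs' = cs cs[THEN left_commute]
  have uw: "u * w = k * (w * u)"
  proof -
    have "u * w - k * (w * u) = (u * v - k * (v * u)) * b - c * (b * (u * v - k * (v * u)))
         - k * (v * (b * u - u * b)) + c * ((b * u - u * b) * v)"
      unfolding w_def by (simp add: algebra_simps cs')
    then show ?thesis using ub uv by simp
  qed
  have "v * w - k * (w * v) = (u * w - k * (w * u)) * a - c * (a * (u * w - k * (w * u)))
         + u * (a * w - w * a) + k * c * ((w * a - a * w) * u)"
    unfolding v_def by (simp add: algebra_simps cs')
  then show ?thesis using uw aw by simp
qed

text \<open>Applied with \<open>u\<close>, \<open>v\<close>, \<open>w\<close> the root vectors
  $E_{i,n-1}$, $E_{i,n}$, $E_{i,n'}$ and \<open>e\<close> equal to \<open>e n\<close>. The left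
  annihilator \<open>P\<close> encodes that \<open>w * v\<close> lies in the right ideal generated
  by \<open>u\<close> and \<open>v\<close>.\<close>

lemma kills_middle_product:
  fixes u e p q P :: "'a::ring_1"
  defines "v \<equiv> u * e - p * p * (e * u)"
  defines "w \<equiv> v * e - p * q * (e * v)"
  assumes p: "central_unit p" and q: "central_unit q"
    and we: "w * e = q * q * (e * w)" and uv: "u * v = q * q * (v * u)"
    and Pu: "P * u = 0" and Pv: "P * v = 0"
  shows "P * (w * v) = 0"
proof -
  note C = p[THEN central_unit_central, THEN centralD] q[THEN central_unit_central, THEN centralD]
  note cs = C(1)[of e] C(1)[of u] C(2)[of p] C(2)[of e] C(2)[of u]
  note cs' = cs cs[THEN left_commute]
  have wu: "p * p * q * q * (w * u) = u * w + (p * q - q * q) * (v * v)"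
  proof -
    define H where "H = u * v - q * q * (v * u)"
    have "p * p * q * q * (w * u) - (u * w + (p * q - q * q) * (v * v))
       = p * p * p * q * (e * H) - H * e"
      unfolding H_def w_def v_def by (simp add: algebra_simps cs')
    then show ?thesis using uv by (simp add: H_def)
  qed
  have wv: "p * p * q * q * (w * v) =
      (u * w + (p * q - q * q) * (v * v)) * e
      - p * p * q * q * (e * (u * w + (p * q - q * q) * (v * v)))"
  proof -
    define G where "G = w * e - q * q * (e * w)"
    have "p * p * q * q * (w * v) = p * p * q * q * (w * u) * e
        - p * p * q * q * (e * (p * p * q * q * (w * u))) - p * p * p * p * q * q * (G * u)"
      unfolding G_def w_def v_def by (simp add: algebra_simps cs')
    then show ?thesis using we by (simp only: wu) (simp add: G_def)
  qed
  note CP = C(1)[of P] C(2)[of P] C(1)[of P, THEN left_commute] C(2)[of P, THEN left_commute]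
    C(2)[of p] C(2)[of p, THEN left_commute]
  have Pz: "P * (u * y) = 0" "P * (v * y) = 0" for y
    by (simp_all add: mult.assoc[symmetric] Pu Pv)
  have Peu: "P * (e * u) = 0"
  proof -
    have "p * p * (P * (e * u)) = P * u * e - P * v"
      unfolding v_def by (simp add: algebra_simps CP)
    then show ?thesis using Pu Pv central_unit_mult_eq_0[OF central_unit_mult[OF p p]] by simp
  qed
  then have Peuz: "P * (e * (u * y)) = 0" for y
    by (metis mult.assoc mult_zero_left)
  have Pev: "p * q * (P * (e * (v * v))) = - (P * (w * v))"
  proof -
    have "p * q * (P * (e * v)) = P * v * e - P * w"
      unfolding w_def by (simp add: algebra_simps CP)
    then have "p * q * (P * (e * v)) * v = - (P * w) * v" using Pv by simp
    then show ?thesis by (simp add: mult.assoc)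
  qed
  \<comment> \<open>Applying \<open>P\<close> to \<open>wv\<close> leaves only the term with
    \<open>e * (v * v)\<close>, which \<open>Pev\<close> turns back into \<open>P * (w * v)\<close>.
    The resulting equation is not a tautology: its two coefficients differ by the unit
    \<open>p * q * q * q\<close>.\<close>
  have eq: "p * p * q * q * (P * (w * v)) = p * q * (p * q - q * q) * (P * (w * v))"
  proof -
    have "p * p * q * q * (P * (w * v)) = P * (p * p * q * q * (w * v))"
      by (simp add: mult.assoc CP)
    also have "\<dots> = - (p * q * (p * q - q * q) * (p * q * (P * (e * (v * v)))))"
      unfolding wv
      by (simp add: algebra_simps Pz Peuz CP C[of e] C[of e, THEN left_commute])
    finally show ?thesis by (simp add: Pev)
  qed
  have "p * q * q * q * (P * (w * v)) = 0"
    using eq by (simp add: algebra_simps CP)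
  then show ?thesis using central_unit_mult_eq_0 central_unit_mult p q by blast
qed

section \<open>Right ideals and chains of brackets\<close>

text \<open>In place of the right ideal generated by \<open>X\<close> we use the right ideal of all \<open>y\<close> that are killed
  by every left annihilator of \<open>X\<close>; this needs no bookkeeping of sums.\<close>

definition ann_closure :: "'a::ring_1 set \<Rightarrow> 'a set" where
  "ann_closure X = {y. \<forall>P. (\<forall>x\<in>X. P * x = 0) \<longrightarrow> P * y = 0}"

lemma ann_closureD: "y \<in> ann_closure X \<Longrightarrow> (\<And>x. x \<in> X \<Longrightarrow> P * x = 0) \<Longrightarrow> P * y = 0"
  by (auto simp: ann_closure_def)

lemma ann_closure_mono: "X \<subseteq> Y \<Longrightarrow> ann_closure X \<subseteq> ann_closure Y"
  by (auto simp: ann_closure_def)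

lemma ann_closure_base: "x \<in> X \<Longrightarrow> x \<in> ann_closure X"
  by (auto simp: ann_closure_def)

lemma ann_closure_mult_right: "y \<in> ann_closure X \<Longrightarrow> y * z \<in> ann_closure X"
  by (auto simp: ann_closure_def mult.assoc[symmetric])

lemma ann_closure_diff: "y \<in> ann_closure X \<Longrightarrow> z \<in> ann_closure X \<Longrightarrow> y - z \<in> ann_closure X"
  by (auto simp: ann_closure_def algebra_simps)

lemma ann_closure_central: "central c \<Longrightarrow> y \<in> ann_closure X \<Longrightarrow> c * y \<in> ann_closure X"
  by (metis ann_closure_mult_right centralD)

lemma ann_closure_mult_left:
  assumes "y \<in> ann_closure X" "\<And>x. x \<in> X \<Longrightarrow> z * x \<in> ann_closure Y"
  shows "z * y \<in> ann_closure Y"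
  using assms unfolding ann_closure_def by (simp add: mult.assoc[symmetric])

lemma ann_closure_qcommute:
  assumes "qcommute z x" "x \<in> X"
  shows "z * x \<in> ann_closure X"
proof -
  obtain c where "central_unit c" "z * x = c * (x * z)"
    using assms(1) by (auto simp: qcommute_def)
  then show ?thesis
    by (simp add: ann_closure_central ann_closure_mult_right ann_closure_base assms(2)
        central_unit_central)
qed

lemma ann_closure_raise:
  assumes "central_unit c" "x \<in> X" "x * e - c * (e * x) \<in> X"
  shows "e * x \<in> ann_closure X"
proof -
  obtain c' where c: "central c'" "c * c' = 1" "central c"
    using assms(1) by (auto simp: central_unit_def)
  then have "c' * c = 1" by (metis centralD)
  then have "e * x = c' * (x * e - (x * e - c * (e * x)))"
    by (simp add: mult.assoc[symmetric])
  then show ?thesis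
    using assms c by (metis ann_closure_base ann_closure_central ann_closure_diff
        ann_closure_mult_right)
qed

text \<open>A subring containing all central elements, hence closed under twisted brackets;
  membership of the simple root vectors therefore passes to all root vectors built from
  them.\<close>

definition stabiliser :: "'a::ring_1 set \<Rightarrow> 'a set" where
  "stabiliser X = {z. \<forall>y \<in> ann_closure X. z * y \<in> ann_closure X}"

lemma stabiliser_mult: "y \<in> stabiliser X \<Longrightarrow> z \<in> stabiliser X \<Longrightarrow> y * z \<in> stabiliser X"
  by (simp add: stabiliser_def mult.assoc)

lemma stabiliser_diff: "y \<in> stabiliser X \<Longrightarrow> z \<in> stabiliser X \<Longrightarrow> y - z \<in> stabiliser X"
  by (simp add: stabiliser_def left_diff_distrib ann_closure_diff)

lemma stabiliser_central: "central c \<Longrightarrow> c \<in> stabiliser X"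
  by (simp add: stabiliser_def ann_closure_central)

lemma stabiliser_bracket:
  "central c \<Longrightarrow> y \<in> stabiliser X \<Longrightarrow> z \<in> stabiliser X \<Longrightarrow> y * z - c * (z * y) \<in> stabiliser X"
  by (simp add: stabiliser_diff stabiliser_mult stabiliser_central)

lemma stabiliser_power: "y \<in> stabiliser X \<Longrightarrow> y ^ k \<in> stabiliser X"
  by (induction k) (auto simp: stabiliser_mult stabiliser_central central_one)

lemma stabiliser_prod_list: "set ys \<subseteq> stabiliser X \<Longrightarrow> prod_list ys \<in> stabiliser X"
  by (induction ys) (auto simp: stabiliser_mult stabiliser_central central_one)

text \<open>\<open>\<kappa> m\<close> is the index of the only letter that moves \<open>x m\<close>
  along the chain; the guard \<open>m < N\<close> says that the last vector \<open>x N\<close> is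
  moved by none. \<open>K\<close> is the set of indices of the acting letters.\<close>

locale bracket_chain =
  fixes x :: "nat \<Rightarrow> 'a::ring_1" and e :: "nat \<Rightarrow> 'a" and \<kappa> :: "nat \<Rightarrow> nat"
    and c :: "nat \<Rightarrow> 'a" and N :: nat and K :: "nat set"
  assumes unit: "m < N \<Longrightarrow> central_unit (c m)"
    and step: "m < N \<Longrightarrow> x (Suc m) = x m * e (\<kappa> m) - c m * (e (\<kappa> m) * x m)"
    and idx: "m < N \<Longrightarrow> \<kappa> m \<in> K"
    and qcomm: "k \<in> K \<Longrightarrow> m \<le> N \<Longrightarrow> \<not> (m < N \<and> k = \<kappa> m) \<Longrightarrow> qcommute (e k) (x m)"
begin

abbreviation (input) I :: "nat \<Rightarrow> 'a set" where
  "I m \<equiv> ann_closure (x ` {..m})"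

lemma I_mono: "m \<le> m' \<Longrightarrow> I m \<subseteq> I m'"
  by (intro ann_closure_mono image_mono) auto

lemma x_mem_I: "j \<le> m \<Longrightarrow> x j \<in> I m"
  by (intro ann_closure_base) auto

lemma e_mult_x: 
  assumes "k \<in> K" "j \<le> N"
  shows "e k * x j \<in> ann_closure (if j < N \<and> k = \<kappa> j then {x j, x (Suc j)} else {x j})"
proof (cases "j < N \<and> k = \<kappa> j")
  case True
  then show ?thesis using ann_closure_raise[OF unit[of j], of "x j" "{x j, x (Suc j)}" "e k"] step[of j]
    by simp
next
  case False
  then show ?thesis using ann_closure_qcommute[OF qcomm[of k j], of "{x j}"] assms by auto
qed

text \<open>A letter moves \<open>x j\<close> at most to \<open>x (Suc j)\<close>, so among the
  generators of \<open>I m\<close> only \<open>x m\<close> can leave; the fourth hypothesis enlarges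
  the ideal in exactly that case.\<close>

lemma e_mult_mem:
  assumes "k \<in> K" "m \<le> N" "y \<in> I m" "m < N \<Longrightarrow> k = \<kappa> m \<Longrightarrow> m < m'" "m \<le> m'"
  shows "e k * y \<in> I m'"
proof (rule ann_closure_mult_left[OF assms(3)])
  fix z assume "z \<in> x ` {..m}"
  then obtain j where j: "j \<le> m" "z = x j" by auto
  have "(if j < N \<and> k = \<kappa> j then {x j, x (Suc j)} else {x j}) \<subseteq> x ` {..m'}"
    using j assms by (cases "j = m") auto
  then show "e k * z \<in> I m'"
    using e_mult_x[of k j] j assms ann_closure_mono by (metis le_trans subsetD)
qed

text \<open>Expanding the left factor as a bracket and moving its letter past \<open>x m\<close>
  gives \<open>T\<close>. Then the right factor is expanded and its letter moved past
  \<open>x (Suc (Suc m))\<close>; this letter sends \<open>I m\<close> into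
  \<open>I (Suc m)\<close>. The inequalities between indices permit both moves.\<close>

lemma adjacent_step:
  assumes m: "Suc (Suc m) \<le> N" and adj: "x (Suc m) * x m \<in> I m"
    and ne: "\<kappa> (Suc m) \<noteq> \<kappa> m" "Suc (Suc m) < N \<Longrightarrow> \<kappa> (Suc (Suc m)) \<noteq> \<kappa> m"
  shows "x (Suc (Suc m)) * x (Suc m) \<in> I (Suc m)"
proof -
  let ?f = "e (\<kappa> (Suc m))" and ?e = "e (\<kappa> m)" and ?w = "x (Suc (Suc m))"
  obtain u where u: "central_unit u" "?f * x m = u * (x m * ?f)"
    using qcomm[of "\<kappa> (Suc m)" m] idx[of "Suc m"] m ne(1) by (auto simp: qcommute_def)
  obtain v where v: "central_unit v" "?w * ?e = v * (?e * ?w)"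
    using qcomm[of "\<kappa> m" "Suc (Suc m)", THEN qcommute_sym] idx[of m] m ne(2)
    by (fastforce simp: qcommute_def)
  have c: "central (c (Suc m))" "central (c m)" "central u" "central v"
    using unit m u v by (auto intro: central_unit_central)
  have "?w * x m = x (Suc m) * (?f * x m) - c (Suc m) * (?f * (x (Suc m) * x m))"
    unfolding step[OF Suc_le_lessD[OF m]] by (simp add: algebra_simps)
  also have "x (Suc m) * (?f * x m) = u * (x (Suc m) * x m * ?f)"
    using centralD[OF c(3)] unfolding u(2) by (metis mult.assoc)
  finally have "?w * x m = u * (x (Suc m) * x m * ?f) - c (Suc m) * (?f * (x (Suc m) * x m))" .
  moreover have "?f * (x (Suc m) * x m) \<in> I m"
    using m ne idx[of "Suc m"] by (intro e_mult_mem[OF _ _ adj]) auto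
  ultimately have T: "?w * x m \<in> I m"
    using adj c by (simp add: ann_closure_diff ann_closure_central ann_closure_mult_right)
  have "x (Suc m) = x m * ?e - c m * (?e * x m)"
    using step[of m] m by simp
  then have "?w * x (Suc m) = ?w * x m * ?e - c m * (?w * ?e * x m)"
    using centralD[OF c(2), THEN left_commute, of ?w] by (metis mult.assoc right_diff_distrib)
  also have "\<dots> = ?w * x m * ?e - c m * (v * (?e * (?w * x m)))"
    by (simp add: v(2) mult.assoc)
  finally have eq: "?w * x (Suc m) = \<dots>" .
  have "?e * (?w * x m) \<in> I (Suc m)"
    using m idx[of m] by (intro e_mult_mem[OF _ _ T]) auto
  moreover have "?w * x m \<in> I (Suc m)" using T I_mono[of m "Suc m"] by auto
  ultimately show ?thesis
    unfolding eq using c by (simp add: ann_closure_diff ann_closure_central ann_closure_mult_right)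
qed

text \<open>Expand the left factor: one term starts with the generator \<open>x (Suc m)\<close>, the
  other is a letter times an element of \<open>I m\<close> by induction, and a letter raises the
  ideal by at most one.\<close>

lemma x_mult_x:
  assumes adj: "\<And>m. m < N \<Longrightarrow> x (Suc m) * x m \<in> I m"
  shows "m < N \<Longrightarrow> j \<le> m \<Longrightarrow> x (Suc m) * x j \<in> I m"
proof (induction m arbitrary: j)
  case 0
  then show ?case using adj[of 0] by simp
next
  case (Suc m)
  show ?case
  proof (cases "j = Suc m")
    case True
    then show ?thesis using adj[of "Suc m"] Suc.prems by simp
  next
    case False
    let ?e = "e (\<kappa> (Suc m))"
    have "x (Suc (Suc m)) * x j = x (Suc m) * (?e * x j) - c (Suc m) * (?e * (x (Suc m) * x j))"
      unfolding step[OF Suc.prems(1)] by (simp add: algebra_simps)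
    moreover have "?e * (x (Suc m) * x j) \<in> I (Suc m)"
      using Suc False idx[of "Suc m"] by (intro e_mult_mem[OF _ _ Suc.IH]) auto
    ultimately show ?thesis
      using unit[of "Suc m"] Suc.prems
      by (simp add: ann_closure_diff ann_closure_central ann_closure_mult_right x_mem_I
          central_unit_central)
  qed
qed

text \<open>For \<open>j = Suc m\<close> nilpotency applies. Otherwise every power of
  \<open>x (Suc m)\<close> keeps \<open>x j\<close> inside \<open>I m\<close>, whose generators the
  shorter product kills by induction.\<close>

lemma prod_powers_kill:
  assumes adj: "\<And>m. m < N \<Longrightarrow> x (Suc m) * x m \<in> I m"
    and nil: "\<And>m. m \<le> N \<Longrightarrow> x m ^ l = 0" and "l > 0"
  shows "m \<le> N \<Longrightarrow> j \<le> m \<Longrightarrow> prod_list (map (\<lambda>m. x m ^ (l - 1)) [0..<Suc m]) * x j = 0"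
proof (induction m arbitrary: j)
  case 0
  then show ?case using nil[of 0] power_minus_mult[OF \<open>l > 0\<close>, of "x 0"] by simp
next
  case (Suc m)
  let ?P = "prod_list (map (\<lambda>m. x m ^ (l - 1)) [0..<Suc m])"
  have P: "prod_list (map (\<lambda>m. x m ^ (l - 1)) [0..<Suc (Suc m)]) = ?P * x (Suc m) ^ (l - 1)"
    by (simp add: mult.assoc)
  show ?case
  proof (cases "j = Suc m")
    case True
    then show ?thesis unfolding P
      using nil[of "Suc m"] Suc.prems power_minus_mult[OF \<open>l > 0\<close>, of "x (Suc m)"]
      by (simp add: mult.assoc del: upt_Suc)
  next
    case False
    have "x (Suc m) ^ a * x j \<in> I m" for a
    proof (induction a)
      case 0
      then show ?case using False Suc.prems by (simp add: x_mem_I)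
    next
      case (Suc a)
      then show ?case
        using x_mult_x[OF adj] \<open>Suc m \<le> N\<close>
        by (simp add: mult.assoc) (rule ann_closure_mult_left, auto)
    qed
    then have "?P * (x (Suc m) ^ (l - 1) * x j) = 0"
    proof (rule ann_closureD)
      show "?P * y = 0" if "y \<in> x ` {..m}" for y
        using that Suc.IH Suc.prems(1) by (metis Suc_leD atMost_iff imageE)
    qed
    then show ?thesis unfolding P by (simp add: mult.assoc)
  qed
qed

end

section \<open>Commutation of simple and general root vectors\<close>

text \<open>The positive part alone. \<open>p\<close>, \<open>q\<close>, \<open>p'\<close>,
  \<open>q'\<close> are the images of \<open>r\<close>, \<open>s\<close> and their inverses, so that
  scalars are handled by ring rewriting. The Serre relations are stated as commutation rules between
  a bracket and one of its letters.\<close>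

locale serre_algebra =
  fixes sc :: "complex \<Rightarrow> 'a::ring_1" and r s :: complex and n :: nat and e :: "nat \<Rightarrow> 'a"
    and p q p' q' :: 'a
  assumes sc_scalars: "sc (r^2) = p * p" "sc (r * s) = p * q" "sc (inverse (s^2)) = q' * q'"
    and units: "central_unit p" "central_unit q" "central_unit p'" "central_unit q'"
    and inverses: "p * p' = 1" "q * q' = 1"
    and sum_units: "central_unit (p * p + q * q)" "central_unit (p * p + p * q + q * q)"
    and far_commute: "1 \<le> i \<Longrightarrow> i + 2 \<le> j \<Longrightarrow> j \<le> n \<Longrightarrow> e i * e j = e j * e i"
    and serre_lower: "1 \<le> i \<Longrightarrow> i < n \<Longrightarrow>
      e i * (e i * e (Suc i) - p * p * (e (Suc i) * e i))
      = q * q * ((e i * e (Suc i) - p * p * (e (Suc i) * e i)) * e i)"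
    and serre_upper: "1 \<le> i \<Longrightarrow> Suc i < n \<Longrightarrow>
      (e i * e (Suc i) - p * p * (e (Suc i) * e i)) * e (Suc i)
      = q * q * (e (Suc i) * (e i * e (Suc i) - p * p * (e (Suc i) * e i)))"
    and serre_last: "1 \<le> i \<Longrightarrow> Suc i = n \<Longrightarrow>
      ((e i * e n - p * p * (e n * e i)) * e n - p * q * (e n * (e i * e n - p * p * (e n * e i)))) * e n
      = q * q * (e n * ((e i * e n - p * p * (e n * e i)) * e n
          - p * q * (e n * (e i * e n - p * p * (e n * e i)))))"
begin

abbreviation U :: "nat \<Rightarrow> nat \<Rightarrow> 'a" where
  "U \<equiv> Eup sc r e"

abbreviation V :: "nat \<Rightarrow> nat \<Rightarrow> 'a" where
  "V \<equiv> Epr sc r s n e"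

lemmas cen = units[THEN central_unit_central]

lemma pp: "central (p * p)" and pq: "central (p * q)" and qq: "central (q * q)"
  and qq': "central (q' * q')" and pp': "central (p' * p')"
  by (simp_all add: central_mult cen)

lemma U_Suc: "U i (Suc m) = e i * U (Suc i) m - p * p * (U (Suc i) m * e i)"
  by (simp add: sc_scalars mult.assoc)

lemma V_0: "V i 0 = U i (n - i) * e n - p * q * (e n * U i (n - i))"
  by (simp add: sc_scalars RE_def mult.assoc)

lemma V_Suc: "V i (Suc t) = V i t * e (n - Suc t) - q' * q' * (e (n - Suc t) * V i t)"
  by (simp add: sc_scalars mult.assoc)

declare Eup.simps(2) [simp del] Epr.simps [simp del]

section \<open>Root vectors $E_{i,j}$: \<open>U i m\<close> is $E_{i,i+m}$\<close>

lemma e_commute_U_right: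
  "1 \<le> i \<Longrightarrow> i + m + 2 \<le> k \<Longrightarrow> k \<le> n \<Longrightarrow> e k * U i m = U i m * e k"
proof (induction m arbitrary: i)
  case 0
  then show ?case using far_commute[of i k] by simp
next
  case (Suc m)
  then show ?case unfolding U_Suc
    using far_commute[of i k] by (intro commute_bracket[OF pp]) auto
qed

text \<open>The defining recursion adds letters on the left; since distant letters commute,
  \<open>bracket_assoc\<close> turns it into one adding letters on the right, as the order inside a
  block requires.\<close>

lemma U_Suc_right:
  "1 \<le> i \<Longrightarrow> i + m < n \<Longrightarrow>
    U i (Suc m) = U i m * e (Suc (i + m)) - p * p * (e (Suc (i + m)) * U i m)"
proof (induction m arbitrary: i)
  case 0
  then show ?case by (simp add: U_Suc)
next
  case (Suc m)
  have IH: "U (Suc i) (Suc m) =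
      U (Suc i) m * e (Suc (Suc i + m)) - p * p * (e (Suc (Suc i + m)) * U (Suc i) m)"
    using Suc by simp
  show ?case
    unfolding U_Suc[of i m] U_Suc[of i "Suc m"] IH
    using bracket_assoc[OF pp pp far_commute[of i "Suc (Suc i + m)"], of "U (Suc i) m"] Suc.prems
    by simp
qed

text \<open>The rank three case is \<open>middle_commutes_bracket\<close> with letters
  \<open>e i\<close>, \<open>e (Suc i)\<close>, \<open>e (Suc (Suc i))\<close>, where the unit
  \<open>p * p + q * q\<close> is divided out; all further letters commute with
  \<open>e (Suc i)\<close>.\<close>

lemma e_commute_U_second:
  "1 \<le> i \<Longrightarrow> i + 2 + m \<le> n \<Longrightarrow> e (Suc i) * U i (2 + m) = U i (2 + m) * e (Suc i)"
proof (induction m)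
  case 0
  have U2: "U i 2 = (e i * e (Suc i) - p * p * (e (Suc i) * e i)) * e (Suc (Suc i))
      - p * p * (e (Suc (Suc i)) * (e i * e (Suc i) - p * p * (e (Suc i) * e i)))"
    using U_Suc_right[of i 1] U_Suc_right[of i 0] 0 by (simp add: numeral_2_eq_2)
  show ?case
    unfolding add_0_right U2
    using 0 far_commute[of i "Suc (Suc i)"] serre_upper[of i] serre_lower[of "Suc i"]
    by (intro middle_commutes_bracket[OF pp qq sum_units(1)]) auto
next
  case (Suc m)
  have "U i (2 + Suc m) = U i (2 + m) * e (Suc (i + (2 + m))) - p * p * (e (Suc (i + (2 + m))) * U i (2 + m))"
    using U_Suc_right[of i "2 + m"] Suc by simp
  then show ?case
    using Suc far_commute[of "Suc i" "Suc (i + (2 + m))"]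
      commute_bracket[OF pp, of "e (Suc i)" "U i (2 + m)" "e (Suc (i + (2 + m)))"]
    by simp
qed

lemma e_commute_U_inner:
  "1 \<le> i \<Longrightarrow> i < k \<Longrightarrow> k < i + m \<Longrightarrow> i + m \<le> n \<Longrightarrow> e k * U i m = U i m * e k"
proof (induction m arbitrary: i)
  case 0
  then show ?case by simp
next
  case (Suc m)
  show ?case
  proof (cases "k = Suc i")
    case True
    then show ?thesis using e_commute_U_second[of i "m - 1"] Suc.prems
      by (cases m) auto
  next
    case False
    then show ?thesis unfolding U_Suc
      using Suc.prems far_commute[of i k] by (intro commute_bracket[OF pp] Suc.IH) auto
  qed
qed

lemma U_mult_e_last:
  "1 \<le> i \<Longrightarrow> i + Suc m < n \<Longrightarrow>
    U i (Suc m) * e (i + Suc m) = q * q * (e (i + Suc m) * U i (Suc m))"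
proof (induction m arbitrary: i)
  case 0
  then show ?case using serre_upper[of i] by (simp add: U_Suc)
next
  case (Suc m)
  let ?k = "i + Suc (Suc m)"
  have IH: "U (Suc i) (Suc m) * e ?k = q * q * (e ?k * U (Suc i) (Suc m))"
    using Suc.IH[of "Suc i"] Suc.prems by simp
  show ?case unfolding U_Suc[of i "Suc m"]
    using Suc.prems by (intro bracket_scaled_commute[OF pp qq _ IH] far_commute) auto
qed

lemma U_mult_U_Suc:
  "1 \<le> i \<Longrightarrow> i + m < n \<Longrightarrow> U i m * U i (Suc m) = q * q * (U i (Suc m) * U i m)"
proof (induction m)
  case 0
  then show ?case using serre_lower[of i] by (simp add: U_Suc)
next
  case (Suc m)
  have 1: "U i (Suc m) = U i m * e (Suc (i + m)) - p * p * (e (Suc (i + m)) * U i m)"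
    using U_Suc_right[of i m] Suc.prems by simp
  have 2: "U i (Suc (Suc m)) = U i (Suc m) * e (Suc (i + Suc m))
      - p * p * (e (Suc (i + Suc m)) * U i (Suc m))"
    using U_Suc_right[of i "Suc m"] Suc.prems by simp
  have 3: "e (Suc (i + m)) * U i (Suc (Suc m)) = U i (Suc (Suc m)) * e (Suc (i + m))"
    using e_commute_U_inner[of i "Suc (i + m)" "Suc (Suc m)"] Suc.prems by simp
  have 4: "U i m * e (Suc (i + Suc m)) = e (Suc (i + Suc m)) * U i m"
    using e_commute_U_right[of i m "Suc (i + Suc m)"] Suc.prems by simp
  have 5: "U i m * U i (Suc m) = q * q * (U i (Suc m) * U i m)"
    using Suc by simp
  show ?case
    using bracket_chain_scaled_commute[OF pp qq 4 3[unfolded 2 1] 5[unfolded 1]]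
    unfolding 2 1 .
qed

section \<open>Root vectors $E_{i,j'}$: \<open>V i t\<close> is $E_{i,(n-t)'}$\<close>

lemma V_left:
  "1 \<le> i \<Longrightarrow> Suc i + t < n \<Longrightarrow> V i t = e i * V (Suc i) t - p * p * (V (Suc i) t * e i)"
proof (induction t)
  case 0
  have U: "U i (n - i) = e i * U (Suc i) (n - Suc i) - p * p * (U (Suc i) (n - Suc i) * e i)"
    using U_Suc[of i "n - Suc i"] 0 by (simp add: Suc_diff_Suc)
  \<comment> \<open>The bound gives \<open>n - t \<ge> i + 2\<close>, so every letter appended on
    the right commutes with \<open>e i\<close>.\<close>
  show ?case
    unfolding V_0 U using 0 by (intro bracket_assoc[OF pp pq] far_commute) auto
next
  case (Suc t)
  have IH: "V i t = e i * V (Suc i) t - p * p * (V (Suc i) t * e i)"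
    using Suc by simp
  show ?case
    unfolding V_Suc IH using Suc.prems by (intro bracket_assoc[OF pp qq'] far_commute) auto
qed

text \<open>Descending induction on \<open>i\<close>: the start \<open>Suc i = n\<close> is the
  cubic Serre relation, and further letters on the left commute with \<open>e n\<close>.\<close>

lemma V_0_mult_e: "1 \<le> i \<Longrightarrow> i < n \<Longrightarrow> V i 0 * e n = q * q * (e n * V i 0)"
proof (induction "n - i" arbitrary: i)
  case 0
  then show ?case by simp
next
  case (Suc d)
  show ?case
  proof (cases "Suc i = n")
    case True
    then have "n - i = Suc 0" by auto
    then show ?thesis
      using serre_last[of i] Suc.prems True unfolding V_0 by (simp add: U_Suc)
  next
    case False
    have IH: "V (Suc i) 0 * e n = q * q * (e n * V (Suc i) 0)"
      using Suc False by simp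
    have V: "V i 0 = e i * V (Suc i) 0 - p * p * (V (Suc i) 0 * e i)"
      using V_left[of i 0] Suc.prems False by simp
    show ?thesis unfolding V
      using Suc.prems False by (intro bracket_scaled_commute[OF pp qq _ IH] far_commute) auto
  qed
qed

lemma e_commute_V_low:
  "1 \<le> i \<Longrightarrow> Suc (Suc i) + t < n \<Longrightarrow> e (Suc i) * V i t = V i t * e (Suc i)"
proof (induction t)
  case 0
  then show ?case unfolding V_0
    using far_commute[of "Suc i" n]
    by (intro commute_bracket[OF pq] e_commute_U_inner) auto
next
  case (Suc t)
  then show ?case unfolding V_Suc
    using far_commute[of "Suc i" "n - Suc t"]
    by (intro commute_bracket[OF qq']) auto
qed

lemma inverse_cancel:
  "p * (p' * w) = w" "p' * (p * w) = w" "q * (q' * w) = w" "q' * (q * w) = w"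
proof -
  have "p' * p = 1" "q' * q = 1" using inverses cen(1,2) by (metis centralD)+
  then show "p * (p' * w) = w" "p' * (p * w) = w" "q * (q' * w) = w" "q' * (q * w) = w"
    using inverses by (metis mult.assoc mult_1_left)+
qed

lemma scalar_left_commute:
  "q * (p * w) = p * (q * w)" "q' * (p * w) = p * (q' * w)"
  "q * (p' * w) = p' * (q * w)" "q' * (p' * w) = p' * (q' * w)"
  "e i * (p * w) = p * (e i * w)" "e i * (p' * w) = p' * (e i * w)"
  "e i * (q * w) = q * (e i * w)" "e i * (q' * w) = q' * (e i * w)"
  by (intro left_commute centralD cen)+

text \<open>A quadratic Serre relation factors through its two twists in either order. The primed
  half of a block brackets neighbours in the opposite order with twist \<open>q' * q'\<close>, so
  the relation is needed in that form.\<close>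

lemma serre_lower_inverse:
  assumes "1 \<le> i" "i < n"
  shows "(e (Suc i) * e i - q' * q' * (e i * e (Suc i))) * e i
      = p' * p' * (e i * (e (Suc i) * e i - q' * q' * (e i * e (Suc i))))" (is "?l = ?r")
proof -
  let ?B = "e i * e (Suc i) - p * p * (e (Suc i) * e i)"
  have "?l - ?r = p' * (p' * (q' * (q' * (e i * ?B - q * q * (?B * e i)))))"
    by (simp add: algebra_simps scalar_left_commute inverse_cancel)
  then show ?thesis using serre_lower[OF assms] by simp
qed

lemma serre_upper_inverse:
  assumes "1 \<le> i" "Suc i < n"
  shows "e (Suc i) * (e (Suc i) * e i - q' * q' * (e i * e (Suc i)))
      = p' * p' * ((e (Suc i) * e i - q' * q' * (e i * e (Suc i))) * e (Suc i))" (is "?l = ?r")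
proof -
  let ?B = "e i * e (Suc i) - p * p * (e (Suc i) * e i)"
  have "?l - ?r = p' * (p' * (q' * (q' * (?B * e (Suc i) - q * q * (e (Suc i) * ?B)))))"
    by (simp add: algebra_simps scalar_left_commute inverse_cancel)
  then show ?thesis using serre_upper[OF assms] by simp
qed

lemma sum_inverse_unit: "central_unit (q' * q' + p' * p')"
proof -
  have "q' * q' + p' * p' = (p * p + q * q) * (p' * p' * (q' * q'))"
    using centralD[OF cen(3), of q] inverses
    by (simp add: algebra_simps scalar_left_commute inverse_cancel)
  then show ?thesis using units sum_units by (simp add: central_unit_mult)
qed

lemma V_Suc_mult_e:
  "1 \<le> i \<Longrightarrow> i + Suc t < n \<Longrightarrow>
    V i (Suc t) * e (n - Suc t) = p' * p' * (e (n - Suc t) * V i (Suc t))"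
proof (induction "n - i" arbitrary: i)
  case 0
  then show ?case by simp
next
  case (Suc d)
  show ?case
  proof (cases "Suc i + Suc t = n")
    case True
    then have k: "n - Suc t = Suc i" "n - t = Suc (Suc i)" by auto
    \<comment> \<open>\<open>Y\<close> is the predecessor of \<open>V i t\<close> in the block:
      $E_{i,n}$ with twist \<open>p * q\<close> if \<open>t = 0\<close>, otherwise $E_{i,(i+3)'}$
      with twist \<open>q' * q'\<close>. Reassociating then isolates a bracket of
      \<open>e (Suc (Suc i))\<close> with \<open>e (Suc i)\<close>.\<close>
    obtain c Y where c: "central c" and Y: "Y * e (Suc i) = e (Suc i) * Y"
      and V: "V i t = Y * e (Suc (Suc i)) - c * (e (Suc (Suc i)) * Y)"
    proof (cases t)
      case 0
      show ?thesis
      proof (rule that[of "p * q" "U i (n - i)"])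
        show "U i (n - i) * e (Suc i) = e (Suc i) * U i (n - i)"
          using e_commute_U_inner[of i "Suc i" "n - i"] Suc.prems True by simp
      qed (use pq V_0[of i] 0 k in auto)
    next
      case (Suc t')
      show ?thesis
      proof (rule that[of "q' * q'" "V i t'"])
        show "V i t' * e (Suc i) = e (Suc i) * V i t'"
          using e_commute_V_low[of i t'] Suc.prems Suc True by simp
      qed (use qq' V_Suc[of i t'] Suc k in auto)
    qed
    have "V i (Suc t) = Y * (e (Suc (Suc i)) * e (Suc i) - q' * q' * (e (Suc i) * e (Suc (Suc i))))
        - c * ((e (Suc (Suc i)) * e (Suc i) - q' * q' * (e (Suc i) * e (Suc (Suc i)))) * Y)"
      unfolding V_Suc k V by (rule bracket_assoc[OF c qq' Y])
    then show ?thesis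
      unfolding k using bracket_scaled_commute[OF c pp' Y serre_lower_inverse] True by simp
  next
    case False
    have IH: "V (Suc i) (Suc t) * e (n - Suc t) = p' * p' * (e (n - Suc t) * V (Suc i) (Suc t))"
      using Suc False by simp
    have V: "V i (Suc t) = e i * V (Suc i) (Suc t) - p * p * (V (Suc i) (Suc t) * e i)"
      using V_left[of i "Suc t"] Suc.prems False by simp
    show ?thesis unfolding V
      using Suc.prems False by (intro bracket_scaled_commute[OF pp pp' _ IH] far_commute) auto
  qed
qed

lemma e_qcommute_V:
  "1 \<le> i \<Longrightarrow> i + t < n \<Longrightarrow> i < k \<Longrightarrow> k \<le> n \<Longrightarrow> k \<noteq> n - Suc t \<Longrightarrow> qcommute (e k) (V i t)"
proof (induction "n - i" arbitrary: i t)
  case 0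
  then show ?case by simp
next
  case (Suc d)
  have far: "qcommute (e k) (V i t)" if "Suc i + t < n" "Suc i < k" "k \<noteq> n - Suc t" for t
  proof -
    have "qcommute (e k) (V (Suc i) t)"
      using Suc.hyps(1)[of "Suc i" t] Suc.hyps(2) Suc.prems(4) that by simp
    moreover have "qcommute (e k) (e i)"
      using far_commute[of i k] Suc.prems that by (intro commute_qcommute) simp
    ultimately show ?thesis
      unfolding V_left[OF Suc.prems(1) that(1)] by (intro qcommute_bracket[OF pp])
  qed
  \<comment> \<open>If \<open>n - t > i + 1\<close>, then \<open>e i\<close> splits off on the left.
    Otherwise \<open>e (Suc i)\<close> is the last letter of \<open>V i t\<close>, and only
    \<open>k = i + 2\<close> calls for the rank three identities.\<close>
  consider "Suc i + t < n" "Suc i < k" | "Suc i + t < n" "k = Suc i"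
    | "Suc i + t = n" "k = Suc i" "t = 0"
    | t' where "Suc i + t = n" "k = Suc i" "t = Suc t'"
    | t' where "Suc i + t = n" "k = Suc (Suc i)" "t = Suc (Suc t')"
    | "Suc i + t = n" "k = Suc (Suc i)" "t = Suc 0"
    | t' where "Suc i + t = n" "Suc (Suc i) < k" "t = Suc t'"
  proof -
    have "t = 0 \<or> t = Suc 0 \<or> t = Suc (Suc (t - 2))" by auto
    moreover have "t = 0 \<or> t = Suc (t - 1)" by auto
    moreover have "Suc i + t < n \<or> Suc i + t = n" using Suc.prems by auto
    moreover have "k = Suc i \<or> k = Suc (Suc i) \<or> Suc (Suc i) < k" using Suc.prems by auto
    moreover have "t \<noteq> 0" if "Suc i + t = n" "Suc i < k" using that Suc.prems by auto
    moreover have "k = Suc (Suc i) \<or> Suc (Suc i) < k \<Longrightarrow> Suc i < k" by auto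
    ultimately show ?thesis using that by metis
  qed
  then show ?case
  proof cases
    case 1
    then show ?thesis using far Suc.prems by simp
  next
    \<comment> \<open>Here \<open>k \<noteq> n - Suc t\<close> excludes
      \<open>n - t = i + 2\<close>, which supplies the stricter bound of
      \<open>e_commute_V_low\<close>.\<close>
    case 2
    then show ?thesis
      using e_commute_V_low[of i t] Suc.prems by (intro commute_qcommute) auto
  next
    case 3
    then have "k = n" by simp
    then show ?thesis
      unfolding \<open>t = 0\<close> using V_0_mult_e[of i] Suc.prems
      by (intro qcommuteI'[of "q * q"] central_unit_mult units) simp
  next
    case 4
    then have "n - Suc t' = Suc i" by auto
    then show ?thesis
      unfolding 4(2,3) using V_Suc_mult_e[of i t'] Suc.prems 4
      by (intro qcommuteI'[of "p' * p'"] central_unit_mult units) simp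
  next
    case 5
    then have k: "n - Suc t' = Suc (Suc i)" "n - Suc (Suc t') = Suc i" by auto
    have V1: "V i (Suc t') = V i t' * e (Suc (Suc i)) - q' * q' * (e (Suc (Suc i)) * V i t')"
      using V_Suc[of i t'] k by simp
    have V2: "V i t = V i (Suc t') * e (Suc i) - q' * q' * (e (Suc i) * V i (Suc t'))"
      using V_Suc[of i "Suc t'"] k 5 by simp
    have Vb: "V i t' * e (Suc i) = e (Suc i) * V i t'"
      using e_commute_V_low[of i t'] Suc.prems 5 by simp
    have Ve: "V i (Suc t') * e (Suc (Suc i)) = p' * p' * (e (Suc (Suc i)) * V i (Suc t'))"
      using V_Suc_mult_e[of i t'] Suc.prems 5 k by simp
    have S: "e (Suc (Suc i)) * (e (Suc (Suc i)) * e (Suc i) - q' * q' * (e (Suc i) * e (Suc (Suc i))))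
      = p' * p' * ((e (Suc (Suc i)) * e (Suc i) - q' * q' * (e (Suc i) * e (Suc (Suc i)))) * e (Suc (Suc i)))"
      using serre_upper_inverse[of "Suc i"] 5 by simp
    show ?thesis
      unfolding 5(2) V2 V1
      by (intro commute_qcommute
          middle_commutes_bracket[OF qq' pp' sum_inverse_unit Vb Ve[unfolded V1] S])
  next
    \<comment> \<open>The short-root end, with \<open>n = i + 2\<close>: the letter
      \<open>e n\<close> has been appended twice, so a double bracket replaces the simple one of the
      previous case.\<close>
    case 6
    then have k: "n = Suc (Suc i)" by auto
    have n2: "n - i = Suc (Suc 0)" using k by simp
    let ?a = "e (Suc (Suc i))" and ?b = "e (Suc i)"
    have U2: "U i (Suc (Suc 0)) = U i (Suc 0) * ?a - p * p * (?a * U i (Suc 0))"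
      using U_Suc_right[of i "Suc 0"] Suc.prems k by simp
    have V0: "V i 0 = U i (Suc (Suc 0)) * ?a - p * q * (?a * U i (Suc (Suc 0)))"
      unfolding V_0 n2 unfolding k ..
    have V1: "V i t = V i 0 * ?b - q' * q' * (?b * V i 0)"
      using V_Suc[of i 0] k 6 by simp
    have Ub: "U i (Suc (Suc 0)) * ?b = ?b * U i (Suc (Suc 0))"
      using e_commute_U_second[of i 0] k Suc.prems by (simp add: numeral_2_eq_2)
    have Xb: "U i (Suc 0) * ?b = q * q * (?b * U i (Suc 0))"
      using U_mult_e_last[of i 0] k Suc.prems by simp
    have Va: "V i 0 * ?a = q * q * (?a * V i 0)"
      using V_0_mult_e[of i] k Suc.prems by simp
    have Ba: "((?b * ?a - p * p * (?a * ?b)) * ?a - p * q * (?a * (?b * ?a - p * p * (?a * ?b)))) * ?a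
      = q * q * (?a * ((?b * ?a - p * p * (?a * ?b)) * ?a - p * q * (?a * (?b * ?a - p * p * (?a * ?b)))))"
      using serre_last[of "Suc i"] k by simp
    have "V i t * ?a = p * p * q * q * (?a * V i t)"
      unfolding V1 V0 U2
      by (intro double_bracket_qcommute[OF units(1,2) sum_units(2)]
          Ub[unfolded U2] Xb Va[unfolded V0 U2] Ba cen(4) inverses(2))
    then show ?thesis
      unfolding 6(2) by (intro qcommuteI'[of "p * p * q * q"] central_unit_mult units)
  next
    case 7
    then have k: "n - Suc t' = Suc i" by auto
    have "qcommute (e k) (V i t')" using far[of t'] 7 Suc.prems by simp
    moreover have "qcommute (e k) (e (Suc i))"
      using far_commute[of "Suc i" k] Suc.prems 7 by (intro commute_qcommute) simp
    ultimately show ?thesis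
      unfolding 7(3) V_Suc k by (intro qcommute_bracket[OF qq'])
  qed
qed

end

section \<open>Blocks of root vectors\<close>

context serre_algebra
begin

text \<open>\<open>root_seq i\<close> enumerates the root vectors of the \<open>i\<close>-th block in the order
  \<open>E_{i,i}, \<dots>, E_{i,n}, E_{i,n'}, \<dots>, E_{i,(i+1)'}\<close>; the passage from the \<open>m\<close>-th to the next one brackets
  with \<open>e (step_idx i m)\<close>.\<close>

definition root_seq :: "nat \<Rightarrow> nat \<Rightarrow> 'a" where
  "root_seq i m = (if m \<le> n - i then U i m else V i (m - (n - i) - 1))"

definition step_idx :: "nat \<Rightarrow> nat \<Rightarrow> nat" where
  "step_idx i m = (if m < n - i then Suc (i + m) else n - (m - (n - i)))"

definition step_coeff :: "nat \<Rightarrow> nat \<Rightarrow> 'a" where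
  "step_coeff i m = (if m < n - i then p * p else if m = n - i then p * q else q' * q')"

definition block :: "nat \<Rightarrow> nat \<Rightarrow> 'a" where
  "block l i = prod_list (map (\<lambda>m. root_seq i m ^ (l - 1)) [0..<Suc (2 * (n - i))])"

lemma bracket_chain_root_seq:
  assumes i: "1 \<le> i"
  shows "bracket_chain (root_seq i) e (step_idx i) (step_coeff i) (2 * (n - i)) {i<..n}"
proof
  fix m assume m: "m < 2 * (n - i)"
  show "central_unit (step_coeff i m)"
    by (simp add: step_coeff_def central_unit_mult units)
  show "step_idx i m \<in> {i<..n}"
    using m by (auto simp: step_idx_def)
  show "root_seq i (Suc m) = root_seq i m * e (step_idx i m)
      - step_coeff i m * (e (step_idx i m) * root_seq i m)"
  proof (rule linorder_cases[of m "n - i"])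
    assume "m < n - i"
    then show ?thesis
      using U_Suc_right[of i m] i by (simp add: root_seq_def step_idx_def step_coeff_def)
  next
    assume "m = n - i"
    then show ?thesis
      using V_0[of i] by (simp add: root_seq_def step_idx_def step_coeff_def)
  next
    assume "n - i < m"
    then obtain t where t: "m = n - i + Suc t" by (metis less_imp_Suc_add add_Suc_right)
    then show ?thesis
      using V_Suc[of i t] by (simp add: root_seq_def step_idx_def step_coeff_def)
  qed
next
  fix k m assume k: "k \<in> {i<..n}" and m: "m \<le> 2 * (n - i)"
    and ne: "\<not> (m < 2 * (n - i) \<and> k = step_idx i m)"
  show "qcommute (e k) (root_seq i m)"
  proof (cases "m \<le> n - i")
    case True
    have x: "root_seq i m = U i m" using True by (simp add: root_seq_def)
    consider "i + m + 2 \<le> k" | "k = Suc (i + m)" | "k = i + m" | "k < i + m" by linarith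
    then show ?thesis
    proof cases
      case 1
      then show ?thesis unfolding x
        using i k by (intro commute_qcommute e_commute_U_right) auto
    next
      case 2
      then have "step_idx i m = k" "m < 2 * (n - i)" using k by (auto simp: step_idx_def)
      then show ?thesis using ne by simp
    next
      case 3
      have "m \<noteq> n - i" using ne k 3 by (auto simp: step_idx_def)
      moreover have "m = Suc (m - 1)" using k 3 by auto
      ultimately show ?thesis unfolding x
        using U_mult_e_last[of i "m - 1"] i k 3 True
        by (intro qcommuteI'[of "q * q"] central_unit_mult units) simp
    next
      case 4
      then show ?thesis unfolding x
        using i k True by (intro commute_qcommute e_commute_U_inner) auto
    qed
  next
    case False
    then obtain t where t: "m = n - i + Suc t" by (metis less_imp_Suc_add add_Suc_right not_le)
    have "step_idx i m = n - Suc t" using t by (simp add: step_idx_def)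
    moreover have "m < 2 * (n - i)" if "k = n - Suc t" using that k t by simp
    ultimately have "k \<noteq> n - Suc t" using ne by auto
    moreover have "root_seq i m = V i t" "i + t < n" using t m k by (auto simp: root_seq_def)
    ultimately show ?thesis using e_qcommute_V[of i t k] i k by simp
  qed
qed

lemma root_seq_adjacent:
  assumes i: "1 \<le> i"
  shows "m < 2 * (n - i) \<Longrightarrow>
    root_seq i (Suc m) * root_seq i m \<in> ann_closure (root_seq i ` {..m})"
proof (induction m)
  case 0
  have "qcommute (U i (Suc 0)) (U i 0)"
    using U_mult_U_Suc[of i 0] i 0 by (intro qcommuteI'[of "q * q"] central_unit_mult units) simp
  then show ?case
    using 0 by (intro ann_closure_qcommute) (auto simp: root_seq_def)
next
  case (Suc m)
  \<comment> \<open>At \<open>Suc m = n - i\<close> two consecutive steps both bracket with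
    \<open>e n\<close>, which \<open>adjacent_step\<close> excludes;
    \<open>kills_middle_product\<close> covers this passage. From \<open>n - i\<close> on the step
    indices strictly decrease and \<open>adjacent_step\<close> applies.\<close>
  consider "Suc m < n - i" | "Suc m = n - i" | "n - i \<le> m" by linarith
  then show ?case
  proof cases
    case 1
    then have "qcommute (U i (Suc (Suc m))) (U i (Suc m))"
      using U_mult_U_Suc[of i "Suc m"] i
      by (intro qcommuteI'[of "q * q"] central_unit_mult units) simp
    then show ?thesis
      using 1 by (intro ann_closure_qcommute) (auto simp: root_seq_def)
  next
    case 2
    let ?u = "U i m" and ?v = "U i (Suc m)" and ?w = "V i 0"
    have n: "Suc (i + m) = n" "i + m < n" using 2 by auto
    have v: "?v = ?u * e n - p * p * (e n * ?u)"
      using U_Suc_right[of i m] i n by simp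
    have w: "?w = ?v * e n - p * q * (e n * ?v)"
      using V_0[of i] 2 by simp
    have we: "?w * e n = q * q * (e n * ?w)" using V_0_mult_e[of i] i n by simp
    have uv: "?u * ?v = q * q * (?v * ?u)" using U_mult_U_Suc[of i m] i n by simp
    have "P * (?w * ?v) = 0" if "P * ?u = 0" "P * ?v = 0" for P
      unfolding w v
      by (intro kills_middle_product[OF units(1,2)]) (use we uv that in \<open>simp_all only: w v\<close>)
    then have "?w * ?v \<in> ann_closure {?u, ?v}" by (simp add: ann_closure_def)
    moreover have x: "root_seq i m = ?u" "root_seq i (Suc m) = ?v" "root_seq i (Suc (Suc m)) = ?w"
      using 2 by (simp_all add: root_seq_def)
    have "{?u, ?v} \<subseteq> root_seq i ` {..Suc m}"
      using x(1,2)[symmetric] by auto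
    ultimately show ?thesis
      unfolding x using ann_closure_mono by blast
  next
    case 3
    then show ?thesis
      using Suc by (intro bracket_chain.adjacent_step[OF bracket_chain_root_seq[OF i]])
        (auto simp: step_idx_def)
  qed
qed

lemma block_kills_root_seq:
  assumes "1 \<le> i" "l > 0" "\<And>m. m \<le> 2 * (n - i) \<Longrightarrow> root_seq i m ^ l = 0" "j \<le> 2 * (n - i)"
  shows "block l i * root_seq i j = 0"
  unfolding block_def
  by (rule bracket_chain.prod_powers_kill[OF bracket_chain_root_seq root_seq_adjacent])
    (use assms in auto)

text \<open>Block \<open>k\<close> consists of iterated brackets of letters \<open>e j\<close> with
  \<open>j > i\<close>, and these preserve the right ideal of the full chain of block
  \<open>i\<close>.\<close>

lemma block_stabiliser:
  assumes i: "1 \<le> i" "i < k" "k \<le> n"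
  shows "block l k \<in> stabiliser (root_seq i ` {..2 * (n - i)})" (is "_ \<in> ?S")
proof -
  have e: "e j \<in> ?S" if "i < j" "j \<le> n" for j
    using that bracket_chain.e_mult_mem[OF bracket_chain_root_seq[OF i(1)], of j "2 * (n - i)"]
    by (auto simp: stabiliser_def)
  have U: "i < j \<Longrightarrow> j + m \<le> n \<Longrightarrow> U j m \<in> ?S" for j m
  proof (induction m arbitrary: j)
    case 0
    then show ?case by (simp add: e)
  next
    case (Suc m)
    then show ?case unfolding U_Suc
      by (intro stabiliser_bracket pp e) auto
  qed
  have V: "j + t < n \<Longrightarrow> i < j \<Longrightarrow> V j t \<in> ?S" for j t
  proof (induction t)
    case 0
    then show ?case unfolding V_0
      by (intro stabiliser_bracket pq e U) auto
  next
    case (Suc t)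
    then show ?case unfolding V_Suc
      by (intro stabiliser_bracket qq' e) auto
  qed
  have "root_seq k m \<in> ?S" if "m \<le> 2 * (n - k)" for m
    using that i U[of k m] V[of k "m - (n - k) - 1"] by (auto simp: root_seq_def)
  then show ?thesis unfolding block_def
    by (intro stabiliser_prod_list) (auto intro!: stabiliser_power)
qed

lemma top_mult_e:
  assumes i: "1 \<le> i" "i \<le> n" and l: "l > 0"
    and nil: "\<And>m. m \<le> 2 * (n - i) \<Longrightarrow> root_seq i m ^ l = 0"
  shows "prod_list (map (block l) [1..<n + 1]) * e i = 0"
proof -
  let ?X = "root_seq i ` {..2 * (n - i)}"
  let ?rest = "prod_list (map (block l) [i + 1..<n + 1])"
  have "[1..<n + 1] = [1..<i] @ i # [i + 1..<n + 1]"
    using i upt_add_eq_append[of 1 i "n + 1 - i"] upt_conv_Cons[of i "n + 1"] by simp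
  then have split: "prod_list (map (block l) [1..<n + 1])
      = prod_list (map (block l) [1..<i]) * (block l i * ?rest)"
    by simp
  have "?rest \<in> stabiliser ?X"
    using i by (intro stabiliser_prod_list) (auto intro: block_stabiliser)
  moreover have "e i \<in> ann_closure ?X"
    by (intro ann_closure_base image_eqI[of _ _ 0]) (auto simp: root_seq_def)
  ultimately have "?rest * e i \<in> ann_closure ?X" by (simp add: stabiliser_def)
  then have "block l i * (?rest * e i) = 0"
    by (rule ann_closureD) (use i l nil in \<open>auto intro: block_kills_root_seq\<close>)
  then show ?thesis unfolding split by (simp add: mult.assoc)
qed

lemma block_eq:
  assumes "i \<le> n"
  shows "prod_list (map (\<lambda>j. RE sc r e i j ^ (l - 1)) [i..<n + 1]) *
     prod_list (map (\<lambda>j. REp sc r s n e i j ^ (l - 1)) (rev [i + 1..<n + 1])) = block l i"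
proof -
  have "[0..<Suc (2 * (n - i))] = [0..<Suc (n - i)] @ [Suc (n - i)..<Suc (2 * (n - i))]"
    using upt_add_eq_append[of 0 "Suc (n - i)" "n - i"] by (simp add: mult_2 del: upt_Suc)
  moreover have "map (\<lambda>j. RE sc r e i j ^ (l - 1)) [i..<n + 1]
      = map (\<lambda>m. root_seq i m ^ (l - 1)) [0..<Suc (n - i)]"
    using assms by (intro nth_equalityI) (auto simp: RE_def root_seq_def nth_append simp del: upt_Suc)
  moreover have "map (\<lambda>j. REp sc r s n e i j ^ (l - 1)) (rev [i + 1..<n + 1])
      = map (\<lambda>m. root_seq i m ^ (l - 1)) [Suc (n - i)..<Suc (2 * (n - i))]"
  proof (intro nth_equalityI)
    fix k assume "k < length (map (\<lambda>j. REp sc r s n e i j ^ (l - 1)) (rev [i + 1..<n + 1]))"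
    then have k: "k < n - i" by (simp del: upt_Suc)
    \<comment> \<open>Position \<open>Suc (n - i) + k\<close> of the chain holds
      \<open>V i k\<close>, that is $E_{i,(n-k)'}$.\<close>
    then have "rev [i + 1..<n + 1] ! k = n - k" "[Suc (n - i)..<Suc (2 * (n - i))] ! k = Suc (n - i) + k"
      using assms by (auto simp: rev_nth simp del: upt_Suc)
    then show "map (\<lambda>j. REp sc r s n e i j ^ (l - 1)) (rev [i + 1..<n + 1]) ! k
      = map (\<lambda>m. root_seq i m ^ (l - 1)) [Suc (n - i)..<Suc (2 * (n - i))] ! k"
      using k by (simp add: REp_def root_seq_def del: upt_Suc)
  qed (simp del: upt_Suc)
  ultimately show ?thesis unfolding block_def by (simp del: upt_Suc)
qed

lemma ordered_product_mult_e:
  assumes i: "1 \<le> i" "i \<le> n" and l: "l > 0"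
    and nil: "\<And>j. i \<le> j \<Longrightarrow> j \<le> n \<Longrightarrow> RE sc r e i j ^ l = 0"
      "\<And>j. i < j \<Longrightarrow> j \<le> n \<Longrightarrow> REp sc r s n e i j ^ l = 0"
  shows "prod_list (map (\<lambda>i. prod_list (map (\<lambda>j. RE sc r e i j ^ (l - 1)) [i..<n + 1]) *
     prod_list (map (\<lambda>j. REp sc r s n e i j ^ (l - 1)) (rev [i + 1..<n + 1]))) [1..<n + 1]) * e i = 0"
    (is "prod_list ?xs * e i = 0")
proof -
  have xs: "?xs = map (block l) [1..<n + 1]"
    by (intro map_cong refl block_eq) (simp del: upt_Suc)
  have "root_seq i m ^ l = 0" if "m \<le> 2 * (n - i)" for m
  proof (cases "m \<le> n - i")
    case True
    then show ?thesis using nil(1)[of "i + m"] i by (simp add: root_seq_def RE_def)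
  next
    case False
    then show ?thesis
      using nil(2)[of "n - (m - (n - i) - 1)"] that by (simp add: root_seq_def REp_def)
  qed
  then show ?thesis unfolding xs by (rule top_mult_e[OF i l])
qed

end

section \<open>Models of the restricted quantum group\<close>

lemma Kfield_mem:
  "r \<in> Kfield r s" "s \<in> Kfield r s" "0 \<in> Kfield r s" "1 \<in> Kfield r s"
  "a \<in> Kfield r s \<Longrightarrow> b \<in> Kfield r s \<Longrightarrow> a + b \<in> Kfield r s"
  "a \<in> Kfield r s \<Longrightarrow> b \<in> Kfield r s \<Longrightarrow> a * b \<in> Kfield r s"
  "a \<in> Kfield r s \<Longrightarrow> inverse a \<in> Kfield r s"
  by (auto simp: Kfield_def is_subfield_def)

lemma primitive_root_nonzero: "primitive_root d z \<Longrightarrow> z \<noteq> 0"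
  by (auto simp: primitive_root_def power_0_left)

lemma conjugate_bracket:
  fixes w w' x y a m :: "'a::ring_1"
  assumes "w' * w = 1" "w * x * w' = m * x" "w * y * w' = a * y" "central a" "central m"
  shows "w * (x * y - a * (y * x)) * w' = m * a * (x * y - a * (y * x))"
proof -
  have 1: "w * (x * y) * w' = m * a * (x * y)"
  proof -
    have "w * (x * y) * w' = w * x * (w' * w) * y * w'" by (simp add: assms(1) mult.assoc)
    also have "\<dots> = (w * x * w') * (w * y * w')" by (simp add: mult.assoc)
    also have "\<dots> = m * a * (x * y)"
      unfolding assms(2,3) using centralD[OF assms(4), of x] by (metis mult.assoc)
    finally show ?thesis .
  qed
  have 2: "w * (y * x) * w' = m * a * (y * x)"
  proof -
    have "w * (y * x) * w' = w * y * (w' * w) * x * w'" by (simp add: assms(1) mult.assoc)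
    also have "\<dots> = (w * y * w') * (w * x * w')" by (simp add: mult.assoc)
    also have "\<dots> = m * a * (y * x)"
      unfolding assms(2,3) using centralD[OF assms(5)] by (metis mult.assoc)
    finally show ?thesis .
  qed
  have "w * (x * y - a * (y * x)) * w' = w * (x * y) * w' - a * (w * (y * x) * w')"
    using centralD[OF assms(4), of w] by (simp add: algebra_simps left_commute)
  also have "\<dots> = m * a * (x * y - a * (y * x))"
    unfolding 1 2 using centralD[OF assms(5), of a, THEN left_commute]
    by (simp add: algebra_simps)
  finally show ?thesis .
qed

text \<open>Both forms expand to the same relation up to a unit: the order of the twists is
  immaterial, and reversing the sides on which letters are added costs the product of all twists,
  with a sign in the cubic case.\<close>

lemma serre_relations_normalised:
  fixes a y p q p' q' :: "'a::ring_1"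
  assumes cen: "central p" "central q" "central p'" "central q'"
    and inv: "p * p' = 1" "q * q' = 1"
  shows "a * (a * y - q * q * (y * a)) - p * p * ((a * y - q * q * (y * a)) * a) = 0 \<Longrightarrow>
      a * (a * y - p * p * (y * a)) = q * q * ((a * y - p * p * (y * a)) * a)"
    and "a * (a * y - p' * p' * (y * a)) - q' * q' * ((a * y - p' * p' * (y * a)) * a) = 0 \<Longrightarrow>
      (y * a - p * p * (a * y)) * a = q * q * (a * (y * a - p * p * (a * y)))"
    and "z = a * y - p' * p' * (y * a) \<Longrightarrow>
      a * (a * z - p' * q' * (z * a)) - q' * q' * ((a * z - p' * q' * (z * a)) * a) = 0 \<Longrightarrow>
      ((y * a - p * p * (a * y)) * a - p * q * (a * (y * a - p * p * (a * y)))) * a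
      = q * q * (a * ((y * a - p * p * (a * y)) * a - p * q * (a * (y * a - p * p * (a * y)))))"
proof -
  note C = cen[THEN centralD]
  have canc: "p * (p' * w) = w" "q * (q' * w) = w" for w
    using inv by (metis mult.assoc mult_1_left)+
  note cs = C(1)[of a] C(2)[of a] C(3)[of a] C(4)[of a] C(1)[of y] C(2)[of y] C(3)[of y] C(4)[of y]
    C(2)[of p] C(2)[of p'] C(4)[of p] C(4)[of p']
  note cs' = cs cs[THEN left_commute] canc
  {
    assume H: "a * (a * y - q * q * (y * a)) - p * p * ((a * y - q * q * (y * a)) * a) = 0"
    have "a * (a * y - p * p * (y * a)) - q * q * ((a * y - p * p * (y * a)) * a)
       = a * (a * y - q * q * (y * a)) - p * p * ((a * y - q * q * (y * a)) * a)"
      by (simp add: algebra_simps cs')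
    then show "a * (a * y - p * p * (y * a)) = q * q * ((a * y - p * p * (y * a)) * a)"
      using H by simp
  next
    assume H: "a * (a * y - p' * p' * (y * a)) - q' * q' * ((a * y - p' * p' * (y * a)) * a) = 0"
    have "(y * a - p * p * (a * y)) * a - q * q * (a * (y * a - p * p * (a * y)))
       = p * p * q * q *
          (a * (a * y - p' * p' * (y * a)) - q' * q' * ((a * y - p' * p' * (y * a)) * a))"
      by (simp add: algebra_simps cs')
    then show "(y * a - p * p * (a * y)) * a = q * q * (a * (y * a - p * p * (a * y)))"
      using H by simp
  next
    assume z: "z = a * y - p' * p' * (y * a)"
      and H: "a * (a * z - p' * q' * (z * a)) - q' * q' * ((a * z - p' * q' * (z * a)) * a) = 0"
    have "((y * a - p * p * (a * y)) * a - p * q * (a * (y * a - p * p * (a * y)))) * a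
      - q * q * (a * ((y * a - p * p * (a * y)) * a - p * q * (a * (y * a - p * p * (a * y)))))
      = - (p * p * p * q * q * q *
        (a * (a * z - p' * q' * (z * a)) - q' * q' * ((a * z - p' * q' * (z * a)) * a)))"
      unfolding z by (simp add: algebra_simps cs')
    then show "((y * a - p * p * (a * y)) * a - p * q * (a * (y * a - p * p * (a * y)))) * a
      = q * q * (a * ((y * a - p * p * (a * y)) * a - p * q * (a * (y * a - p * p * (a * y)))))"
      using H by simp
  }
qed

section \<open>Absorbing and moving generators past the factor \<open>t\<close>\<close>

lemma sum_powers_mult:
  fixes w :: "'a::ring_1"
  assumes "w ^ l = 1"
  shows "(\<Sum>k<l. w ^ k) * w = (\<Sum>k<l. w ^ k)"
proof -
  have "(\<Sum>k<l. w ^ k) * w + 1 = (\<Sum>k<l. w ^ Suc k) + w ^ 0"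
    by (simp add: sum_distrib_right power_Suc2 del: power_Suc)
  also have "\<dots> = (\<Sum>k<Suc l. w ^ k)"
    by (subst sum.lessThan_Suc_shift) (simp add: add.commute)
  also have "\<dots> = (\<Sum>k<l. w ^ k) + 1" by (simp add: assms)
  finally show ?thesis by simp
qed

lemma commute_prod_list:
  "(\<And>y. y \<in> set ys \<Longrightarrow> y * z = z * y) \<Longrightarrow> prod_list ys * z = z * prod_list ys" for z :: "'a::ring_1"
  by (induction ys) (simp_all add: mult.assoc, metis mult.assoc)

lemma commute_sum_powers:
  "w * z = z * w \<Longrightarrow> (\<Sum>k<l. w ^ k) * z = z * (\<Sum>k<l. w ^ k)" for z :: "'a::ring_1"
  by (simp add: sum_distrib_right sum_distrib_left power_commuting_commutes)

text \<open>Moving \<open>z\<close> to the left only rescales the powers of \<open>w\<close>. The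
  remaining factor \<open>P\<close> is not computed, since \<open>z\<close> will be annihilated from
  the left.\<close>

lemma sum_powers_pull:
  fixes w z c :: "'a::ring_1"
  assumes "w * z = c * (z * w)" "central c"
  shows "\<exists>P. (\<Sum>k<l. w ^ k) * z = z * P"
proof -
  have "w ^ k * z = z * (c ^ k * w ^ k)" for k
  proof (induction k)
    case (Suc k)
    have "w ^ Suc k * z = w * (w ^ k * z)" by (simp add: mult.assoc)
    also have "\<dots> = w * z * (c ^ k * w ^ k)" by (simp add: Suc mult.assoc)
    also have "\<dots> = z * (c * w * (c ^ k * w ^ k))"
      using assms(1) centralD[OF assms(2), of z] by (metis mult.assoc)
    also have "\<dots> = z * (c ^ Suc k * w ^ Suc k)"
      using centralD[OF assms(2)] power_commuting_commutes[of c w k] 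
      by (simp add: mult.assoc) (metis mult.assoc)
    finally show ?case .
  qed simp
  then show ?thesis by (auto simp: sum_distrib_right sum_distrib_left[symmetric])
qed

lemma prod_list_pull:
  fixes z :: "'a::ring_1"
  shows "(\<And>y. y \<in> set ys \<Longrightarrow> \<exists>P. y * z = z * P) \<Longrightarrow> \<exists>P. prod_list ys * z = z * P"
proof (induction ys)
  case (Cons y ys)
  then obtain P where "prod_list ys * z = z * P" by force
  moreover obtain Q where "y * z = z * Q" using Cons.prems by force
  ultimately show ?case by (metis mult.assoc prod_list.Cons)
qed (auto intro: exI[of _ 1])

lemma K_algebra_map_one: "K_algebra_map K sc \<Longrightarrow> sc 1 = 1"
  and K_algebra_map_add: "K_algebra_map K sc \<Longrightarrow> a \<in> K \<Longrightarrow> b \<in> K \<Longrightarrow> sc (a + b) = sc a + sc b"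
  and K_algebra_map_mult: "K_algebra_map K sc \<Longrightarrow> a \<in> K \<Longrightarrow> b \<in> K \<Longrightarrow> sc (a * b) = sc a * sc b"
  and K_algebra_map_central: "K_algebra_map K sc \<Longrightarrow> a \<in> K \<Longrightarrow> central (sc a)"
  unfolding K_algebra_map_def central_def by (blast, blast, blast, metis)

lemma K_algebra_map_zero: "K_algebra_map (Kfield r s) sc \<Longrightarrow> sc 0 = 0"
  using K_algebra_map_add[of "Kfield r s" sc 0 0] by (simp add: Kfield_mem)

lemma K_algebra_map_unit:
  assumes "K_algebra_map (Kfield r s) sc" "a \<in> Kfield r s" "a \<noteq> 0"
  shows "central_unit (sc a)"
  unfolding central_unit_def
proof (intro conjI exI)
  show "sc a * sc (inverse a) = 1"
    using K_algebra_map_mult[OF assms(1,2), of "inverse a"] K_algebra_map_one[OF assms(1)] assms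
    by (simp add: Kfield_mem)
qed (simp_all add: K_algebra_map_central[OF assms(1)] assms Kfield_mem)

lemma adl_e_eq:
  "g (W i) * y * g (Wi i) = a * y \<Longrightarrow> adl_e g i y = g (E i) * y - a * (y * g (E i))"
  by (simp add: adl_e_def mult.assoc[symmetric])

lemma u_model_commute:
  "u_model n r s l sc g \<Longrightarrow> a \<in> omega_gens n \<Longrightarrow> b \<in> omega_gens n \<Longrightarrow> g a * g b = g b * g a"
  unfolding u_model_def by blast

lemma u_model_inverse:
  "u_model n r s l sc g \<Longrightarrow> 1 \<le> i \<Longrightarrow> i \<le> n \<Longrightarrow> g (W i) * g (Wi i) = 1 \<and> g (Wi i) * g (W i) = 1"
  unfolding u_model_def by blast

lemma u_model_conj:
  "u_model n r s l sc g \<Longrightarrow> 1 \<le> i \<Longrightarrow> i \<le> n \<Longrightarrow> 1 \<le> j \<Longrightarrow> j \<le> n \<Longrightarrow>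
    g (W j) * g (E i) * g (Wi j) = sc (pairing n r s i j) * g (E i)"
  unfolding u_model_def by blast

lemma u_model_serre:
  "u_model n r s l sc g \<Longrightarrow> 1 \<le> i \<Longrightarrow> i \<le> n \<Longrightarrow> 1 \<le> j \<Longrightarrow> j \<le> n \<Longrightarrow> i \<noteq> j \<Longrightarrow>
    (adl_e g i ^^ serre_exp n i j) (g (E j)) = 0"
  unfolding u_model_def by blast

lemma u_model_nilpotent:
  "u_model n r s l sc g \<Longrightarrow> 1 \<le> k \<Longrightarrow> k \<le> j \<Longrightarrow> j \<le> n \<Longrightarrow> RE sc r (\<lambda>i. g (E i)) k j ^ l = 0"
  "u_model n r s l sc g \<Longrightarrow> 1 \<le> k \<Longrightarrow> k < j \<Longrightarrow> j \<le> n \<Longrightarrow> REp sc r s n (\<lambda>i. g (E i)) k j ^ l = 0"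
  unfolding u_model_def by blast+

lemma u_model_torsion:
  "u_model n r s l sc g \<Longrightarrow> 1 \<le> k \<Longrightarrow> k \<le> n \<Longrightarrow> g (W k) ^ l = 1"
  unfolding u_model_def by blast

lemma serre_algebra_u_model:
  fixes sc :: "complex \<Rightarrow> 'a::ring_1"
  assumes K: "K_algebra_map (Kfield r s) sc" and u: "u_model n r s l sc g"
    and nz: "r \<noteq> 0" "s \<noteq> 0" and "r ^ 3 \<noteq> s ^ 3" and "r ^ 4 \<noteq> s ^ 4"
  shows "serre_algebra sc r s n (\<lambda>i. g (E i)) (sc r) (sc s) (sc (inverse r)) (sc (inverse s))"
proof -
  note sc_one = K_algebra_map_one[OF K] and sc_add = K_algebra_map_add[OF K]
    and sc_mult = K_algebra_map_mult[OF K] and sc_unit = K_algebra_map_unit[OF K]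
  define p q p' q' where "p = sc r" and "q = sc s" and "p' = sc (inverse r)" and "q' = sc (inverse s)"
  note pq_def = p_def q_def p'_def q'_def
  have units: "central_unit p" "central_unit q" "central_unit p'" "central_unit q'"
    unfolding pq_def using nz by (simp_all add: sc_unit Kfield_mem)
  note cen = units[THEN central_unit_central]
  have inv: "p * p' = 1" "q * q' = 1"
    unfolding pq_def using nz by (simp_all add: sc_mult[symmetric] sc_one Kfield_mem)
  have inv': "p' * p = 1" "q' * q = 1" using inv cen by (metis centralD)+
  have canc: "q' * (q * w) = w" "p' * (p * w) = w" for w
    using inv' by (metis mult.assoc mult_1_left)+
  have comm: "q' * p' = p' * q'" "q' * p = p * q'"
    using cen by (simp_all add: centralD)
  have scal: "sc (r^2) = p * p" "sc (s^2) = q * q" "sc (r * s) = p * q"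
    "sc (inverse (s^2)) = q' * q'" "sc (inverse (r^2)) = p' * p'"
    "sc (r^2 * inverse (s^2)) = p * p * (q' * q')" "sc (r * inverse s) = p * q'"
    unfolding pq_def power2_eq_square inverse_mult_distrib by (simp_all add: sc_mult Kfield_mem)
  \<comment> \<open>\<open>r * r + s * s\<close> divides \<open>r ^ 4 - s ^ 4\<close>, and
    \<open>r3\<close> below uses the corresponding factor of \<open>r ^ 3 - s ^ 3\<close>.\<close>
  have r2: "r * r + s * s \<noteq> 0"
  proof
    assume "r * r + s * s = 0"
    then have "r * r = - (s * s)" by (simp add: eq_neg_iff_add_eq_0)
    then have "(r * r) * (r * r) = (s * s) * (s * s)" by simp
    then show False using \<open>r ^ 4 \<noteq> s ^ 4\<close> by (simp add: power4_eq_xxxx mult.assoc)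
  qed
  have r3: "r * r + r * s + s * s \<noteq> 0"
  proof
    assume "r * r + r * s + s * s = 0"
    moreover have "r ^ 3 - s ^ 3 = (r - s) * (r * r + r * s + s * s)"
      by (simp add: power3_eq_cube algebra_simps)
    ultimately show False using \<open>r ^ 3 \<noteq> s ^ 3\<close> by simp
  qed
  have sums: "central_unit (p * p + q * q)" "central_unit (p * p + p * q + q * q)"
    using sc_unit[OF _ r2] sc_unit[OF _ r3] unfolding pq_def by (simp_all add: sc_add sc_mult Kfield_mem)
  let ?e = "\<lambda>i. g (E i)"
  have far: "?e i * ?e j = ?e j * ?e i" if "1 \<le> i" "i + 2 \<le> j" "j \<le> n" for i j
  proof -
    have "serre_exp n i j = 1" using that by (simp add: serre_exp_def cartan_B_def)
    then have "adl_e g i (?e j) = 0" using u_model_serre[OF u, of i j] that by simp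
    moreover have "g (W i) * ?e j * g (Wi i) = 1 * ?e j"
      using u_model_conj[OF u, of j i] that by (simp add: pairing_def sc_one)
    ultimately show ?thesis using adl_e_eq[of g i "?e j" 1] by simp
  qed
  \<comment> \<open>Unfolds two adjoint actions: the first has twist \<open>c\<close>, and the
    second acts on a bracket whose weight is the sum of the weights of its letters, hence the twist
    \<open>d\<close>.\<close>
  have twice: "a * (a * y - c * (y * a)) - d * ((a * y - c * (y * a)) * a) = 0"
    if "a = ?e i" "y = ?e j" "adl_e g i (adl_e g i (?e j)) = 0"
      "1 \<le> i" "i \<le> n" "1 \<le> j" "j \<le> n" "sc (pairing n r s j i) = c" "sc (pairing n r s i i) * c = d"
    and c: "central c" "central (sc (pairing n r s i i))"
    for a y c d i j
  proof -
    have w: "g (W i) * ?e j * g (Wi i) = c * ?e j"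
      using u_model_conj[OF u, of j i] that by simp
    have w': "g (W i) * ?e i * g (Wi i) = sc (pairing n r s i i) * ?e i"
      using u_model_conj[OF u, of i i] that by simp
    have "g (W i) * (?e i * ?e j - c * (?e j * ?e i)) * g (Wi i) = d * (?e i * ?e j - c * (?e j * ?e i))"
      using conjugate_bracket[OF _ w' w c] u_model_inverse[OF u, of i] that by simp
    from adl_e_eq[OF this] adl_e_eq[OF w] that show ?thesis by simp
  qed
  show ?thesis unfolding pq_def[symmetric]
  proof
    fix i assume i: "1 \<le> i" "i < n"
    have "serre_exp n i (Suc i) = 2" using i by (simp add: serre_exp_def cartan_B_def)
    then have ad: "adl_e g i (adl_e g i (?e (Suc i))) = 0"
      using u_model_serre[OF u, of i "Suc i"] i by (simp add: numeral_2_eq_2)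
    have pr: "sc (pairing n r s (Suc i) i) = q * q" "sc (pairing n r s i i) = p * p * (q' * q')"
      using i by (simp_all add: pairing_def scal)
    show "?e i * (?e i * ?e (Suc i) - p * p * (?e (Suc i) * ?e i))
      = q * q * ((?e i * ?e (Suc i) - p * p * (?e (Suc i) * ?e i)) * ?e i)"
      by (rule serre_relations_normalised(1)[OF cen inv], rule twice[OF refl refl ad])
        (use i cen in \<open>auto simp: pr central_mult canc inv' mult.assoc\<close>)
  next
    fix i assume i: "1 \<le> i" "Suc i < n"
    have "serre_exp n (Suc i) i = 2" using i by (simp add: serre_exp_def cartan_B_def)
    then have ad: "adl_e g (Suc i) (adl_e g (Suc i) (?e i)) = 0"
      using u_model_serre[OF u, of "Suc i" i] i by (simp add: numeral_2_eq_2)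
    have pr: "sc (pairing n r s i (Suc i)) = p' * p'"
        "sc (pairing n r s (Suc i) (Suc i)) = p * p * (q' * q')"
      using i by (simp_all add: pairing_def scal)
    have d: "p * p * (q' * q') * (p' * p') = q' * q'"
    proof -
      have "p * p * (q' * q') = q' * q' * (p * p)"
        by (rule centralD[OF central_mult[OF cen(4,4)]])
      then have "p * p * (q' * q') * (p' * p') = q' * q' * (p * (p * p') * p')"
        by (simp only: mult.assoc[of _ _ "p' * p'"]) (simp only: mult.assoc)
      then show ?thesis by (simp add: inv)
    qed
    show "(?e i * ?e (Suc i) - p * p * (?e (Suc i) * ?e i)) * ?e (Suc i)
      = q * q * (?e (Suc i) * (?e i * ?e (Suc i) - p * p * (?e (Suc i) * ?e i)))"
      by (rule serre_relations_normalised(2)[OF cen inv], rule twice[OF refl refl ad])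
        (use i cen in \<open>auto simp: pr central_mult d\<close>)
  next
    fix i assume i: "1 \<le> i" "Suc i = n"
    let ?y = "?e i" and ?a = "?e n"
    let ?z = "?a * ?y - p' * p' * (?y * ?a)"
    have "serre_exp n n i = 3" using i by (auto simp: serre_exp_def cartan_B_def)
    then have ad: "adl_e g n (adl_e g n (adl_e g n ?y)) = 0"
      using u_model_serre[OF u, of n i] i by (simp add: numeral_3_eq_3)
    have w1: "g (W n) * ?y * g (Wi n) = p' * p' * ?y"
      using u_model_conj[OF u, of i n] i by (auto simp: pairing_def scal)
    have wa: "g (W n) * ?a * g (Wi n) = p * q' * ?a"
      using u_model_conj[OF u, of n n] i by (auto simp: pairing_def scal)
    have ww: "g (Wi n) * g (W n) = 1" using u_model_inverse[OF u, of n] i by simp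
    have c: "central (p' * p')" "central (p * q')" "central (p' * q')"
      using cen by (simp_all add: central_mult)
    have d: "p * q' * (p' * p') = p' * q'" "p * q' * (p' * q') = q' * q'"
    proof -
      show "p * q' * (p' * p') = p' * q'"
        by (metis comm(1) inv(1) mult.assoc mult_1_left comm(2))
      show "p * q' * (p' * q') = q' * q'"
        by (metis comm(1) inv(1) mult.assoc mult_1_left)
    qed
    have w2: "g (W n) * ?z * g (Wi n) = p' * q' * ?z"
      using conjugate_bracket[OF ww wa w1 c(1,2)] by (simp only: d)
    have w3: "g (W n) * (?a * ?z - p' * q' * (?z * ?a)) * g (Wi n)
        = q' * q' * (?a * ?z - p' * q' * (?z * ?a))"
      using conjugate_bracket[OF ww wa w2 c(3,2)] by (simp only: d)
    show "((?y * ?a - p * p * (?a * ?y)) * ?a - p * q * (?a * (?y * ?a - p * p * (?a * ?y)))) * ?a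
      = q * q * (?a * ((?y * ?a - p * p * (?a * ?y)) * ?a - p * q * (?a * (?y * ?a - p * p * (?a * ?y)))))"
      by (rule serre_relations_normalised(3)[OF cen inv refl])
        (use ad in \<open>simp only: adl_e_eq[OF w1] adl_e_eq[OF w2] adl_e_eq[OF w3]\<close>)
  qed (fact scal units inv sums | rule far; assumption)+
qed

lemma t_elt_mult_W:
  fixes g :: "gen \<Rightarrow> 'a::ring_1"
  assumes u: "u_model n r s l sc g" and i: "1 \<le> i" "i \<le> n"
  shows "t_elt n l g * g (W i) = t_elt n l g"
proof -
  let ?f = "\<lambda>i. \<Sum>k<l. g (W i) ^ k"
  \<comment> \<open>The \<open>i\<close>-th factor absorbs \<open>g (W i)\<close> once the factors
    to its right have been passed.\<close>
  have absorb: "R * w = w * R \<Longrightarrow> f * w = f \<Longrightarrow> A * (f * R) * w = A * (f * R)" for A R f w :: 'a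
    by (metis mult.assoc)
  have "[1..<n + 1] = [1..<i] @ i # [i + 1..<n + 1]"
    using i upt_add_eq_append[of 1 i "n + 1 - i"] upt_conv_Cons[of i "n + 1"] by simp
  then have t: "t_elt n l g = prod_list (map ?f [1..<i]) * (?f i * prod_list (map ?f [i + 1..<n + 1]))"
    unfolding t_elt_def by simp
  have "prod_list (map ?f [i + 1..<n + 1]) * g (W i) = g (W i) * prod_list (map ?f [i + 1..<n + 1])"
    using i by (intro commute_prod_list)
      (auto intro!: commute_sum_powers u_model_commute[OF u] simp: omega_gens_def simp del: upt_Suc)
  moreover have "?f i * g (W i) = ?f i"
    by (rule sum_powers_mult) (rule u_model_torsion[OF u i])
  ultimately show ?thesis unfolding t by (rule absorb)
qed

lemma t_elt_mult_E:
  assumes u: "u_model n r s l sc g" and i: "1 \<le> i" "i \<le> n"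
    and c: "\<And>j. central (sc (pairing n r s i j))"
  shows "\<exists>P. t_elt n l g * g (E i) = g (E i) * P"
  unfolding t_elt_def
proof (rule prod_list_pull)
  fix y assume "y \<in> set (map (\<lambda>i. \<Sum>k<l. g (W i) ^ k) [1..<n + 1])"
  then obtain j where j: "1 \<le> j" "j \<le> n" "y = (\<Sum>k<l. g (W j) ^ k)" by (auto simp del: upt_Suc)
  have "g (W j) * g (E i) * (g (Wi j) * g (W j)) = sc (pairing n r s i j) * g (E i) * g (W j)"
    using u_model_conj[OF u i j(1,2)] by (simp add: mult.assoc[symmetric])
  then have "g (W j) * g (E i) = sc (pairing n r s i j) * (g (E i) * g (W j))"
    using u_model_inverse[OF u j(1,2)] by (simp add: mult.assoc)
  then show "\<exists>P. y * g (E i) = g (E i) * P"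
    unfolding j by (rule sum_powers_pull[OF _ c])
qed

section \<open>From generators to words and linear combinations\<close>

theorem theorem7p2:
  fixes r s :: complex and n d d' l :: nat
    and sc :: "complex \<Rightarrow> 'a::ring_1" and g :: "gen \<Rightarrow> 'a" and p :: bpoly
  assumes "n \<ge> 2"
    and "primitive_root d r" and "primitive_root d' s"
    and "r ^ 3 \<noteq> s ^ 3" and "r ^ 4 \<noteq> s ^ 4"
    and "l = lcm d d'" and "odd l"
    and "K_algebra_map (Kfield r s) sc"
    and "u_model n r s l sc g"
    and "bpoly_ok n (Kfield r s) p"
  shows "x_elt n r s l sc g * t_elt n l g * b_eval sc g p
         = sc (b_eps p) * (x_elt n r s l sc g * t_elt n l g)"
proof -
  note K = assms(8) and u = assms(9)
  note sc_one = K_algebra_map_one[OF K] and sc_add = K_algebra_map_add[OF K]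
    and sc_mult = K_algebra_map_mult[OF K] and sc_zero = K_algebra_map_zero[OF K]
    and sc_central = K_algebra_map_central[OF K]
  have nz: "r \<noteq> 0" "s \<noteq> 0" using assms(2,3) by (auto dest: primitive_root_nonzero)
  have l: "l > 0" using \<open>odd l\<close> by (simp add: odd_pos)
  let ?y = "x_elt n r s l sc g * t_elt n l g"
  have yE: "?y * g (E i) = 0" if i: "1 \<le> i" "i \<le> n" for i
  proof -
    have "central (sc (pairing n r s i j))" for j
      by (intro sc_central) (auto simp: pairing_def power2_eq_square intro!: Kfield_mem)
    then obtain P where "t_elt n l g * g (E i) = g (E i) * P"
      using t_elt_mult_E[OF u i] by blast
    moreover have "x_elt n r s l sc g * g (E i) = 0"
      unfolding x_elt_def Ehat_def
      by (rule serre_algebra.ordered_product_mult_e[OF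
            serre_algebra_u_model[OF K u nz assms(4,5)] i l])
        (use u_model_nilpotent[OF u] i in auto)
    ultimately show ?thesis by (metis mult.assoc mult_zero_left)
  qed
  have yW: "?y * g (W i) = ?y" if "1 \<le> i" "i \<le> n" for i
    using t_elt_mult_W[OF u that] by (simp add: mult.assoc)
  have yWi: "?y * g (Wi i) = ?y" if "1 \<le> i" "i \<le> n" for i
    using yW[OF that] u_model_inverse[OF u that] by (metis mult.assoc mult_1_right)
  have gen: "?y * g (bgen_gen b) = sc (bgen_eps b) * ?y" if "1 \<le> bgen_idx b" "bgen_idx b \<le> n" for b
    using that by (cases b) (simp_all add: yE yW yWi sc_zero sc_one)
  have eps: "prod_list (map bgen_eps w) \<in> Kfield r s" "bgen_eps b \<in> Kfield r s" for w b
  proof -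
    show b: "bgen_eps b \<in> Kfield r s" for b by (cases b) (simp_all add: Kfield_mem)
    show "prod_list (map bgen_eps w) \<in> Kfield r s"
      by (induction w) (auto intro: Kfield_mem b)
  qed
  have word: "?y * prod_list (map (g \<circ> bgen_gen) w) = sc (prod_list (map bgen_eps w)) * ?y"
    if "\<forall>b \<in> set w. 1 \<le> bgen_idx b \<and> bgen_idx b \<le> n" for w
    using that
  proof (induction w)
    case (Cons b w)
    have "?y * prod_list (map (g \<circ> bgen_gen) (b # w))
        = sc (bgen_eps b) * (?y * prod_list (map (g \<circ> bgen_gen) w))"
      using gen[of b] Cons.prems by (simp add: mult.assoc[symmetric])
    also have "?y * prod_list (map (g \<circ> bgen_gen) w) = sc (prod_list (map bgen_eps w)) * ?y"
      by (rule Cons.IH) (use Cons.prems in simp)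
    finally show ?case by (simp add: sc_mult eps mult.assoc)
  qed (simp add: sc_one)
  \<comment> \<open>Membership in the field is carried along because \<open>sc\<close> is known to
    be additive only there.\<close>
  have "?y * b_eval sc g p = sc (b_eps p) * ?y \<and> b_eps p \<in> Kfield r s"
    using assms(10)
  proof (induction p)
    case Nil
    then show ?case by (simp add: b_eval_def b_eps_def sc_zero Kfield_mem)
  next
    case (Cons cw p)
    obtain c w where cw: "cw = (c, w)" by (cases cw)
    have IH: "?y * b_eval sc g p = sc (b_eps p) * ?y" "b_eps p \<in> Kfield r s"
      and c: "c \<in> Kfield r s" and w: "\<forall>b \<in> set w. 1 \<le> bgen_idx b \<and> bgen_idx b \<le> n"
      using Cons cw by (auto simp: bpoly_ok_def)
    have mem: "c * prod_list (map bgen_eps w) \<in> Kfield r s" using c eps Kfield_mem by blast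
    have ev: "b_eval sc g (cw # p) = sc c * prod_list (map (g \<circ> bgen_gen) w) + b_eval sc g p"
      and ep: "b_eps (cw # p) = c * prod_list (map bgen_eps w) + b_eps p"
      by (simp_all add: b_eval_def b_eps_def cw)
    have "?y * (sc c * prod_list (map (g \<circ> bgen_gen) w)) = sc c * (?y * prod_list (map (g \<circ> bgen_gen) w))"
      using sc_central[OF c] by (intro left_commute centralD)
    also have "\<dots> = sc (c * prod_list (map bgen_eps w)) * ?y"
      unfolding word[OF w] using c eps by (simp add: sc_mult mult.assoc)
    finally show ?case
      unfolding ev ep using IH mem by (simp only: distrib_left distrib_right sc_add Kfield_mem(5))
  qed
  then show ?thesis by simp
qed

end
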